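(* Let $p$ and $k$ be positive integers. With the notation of the context: (i) There exists a bijection $\Xi: F\rightarrow ((T,0),\mathcal C'_k,(S_0,0))$ (between $(p,k)$-forests $F$ and triples consisting of an increasing tree $(T,0)$, an associated colouring $\mathcal C'_k$ of its edges, and a starlike increasing tree $(S_0,0)$). (ii) The mapping in part (i) gives a bijective proof of the identity $$\alpha_{pm}(k)=\sum_{j=m}^{p}{p\brack j}{j\brace m}(k-1)^{p-j}.$$
   Context: ${p\brack j}$ is the signless Stirling number of the first kind and ${j\brace m}$ the Stirling number of the second kind. With $D=\frac{d}{dx}$, the numbers $\alpha_{pm}(k)$ are the coefficients in $(x^kD)^p=x^{p(k-1)}\sum_{m=1}^p\alpha_{pm}(k)x^mD^m$; equivalently, $\alpha_{pm}(k)$ is the number of $(p,k)$-distributions (defined below) in which the urn $x_0$ contains exactly $m$ balls. Increasing trees: for a finite ordered set $V$ with minimum $v_0$, an increasing tree on $V$ is a tree with vertex set $V$ rooted at $v_0$ such that along the unique path from $v_0$ to any vertex the vertices appear increasingly. It is starlike if every vertex except possibly the root has at most one child. $(T,r)$ denotes a tree $T$ with root $r$. $(p,k)$-distribution: a distribution of balls $D_i$ ($1\le i\le p$) into urns $x_j$ ($0\le j\le pk$) such that each urn except $x_0$ (whose capacity is not bounded) contains at most one ball, and a ball $D_i$ can be put into an urn $x_j$ only if $\lceil j/k\rceil<i$. $(p,k)$-forest (related to a $(p,k)$-distribution): a graph $F$ on the vertex set $\{0,1,\dots,(p-1)k+1\}\cup\{r_1,\dots,r_{p-1}\}$ which is a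 disjoint union of starlike increasing trees $(S_0,0),(S_1,r_1),\dots,(S_{p-1},r_{p-1})$, where the symbols $r_i$ are by convention smaller than any positive integer, and: (1) the children of $r_i$ are the vertices $(i-1)k+2,(i-1)k+3,\dots,ik$, for $i=1,\dots,p-1$; (2) if the ball $D_m$ is put into urn $x_0$, then $(m-1)k+1$ is a child of $0$ in $S_0$; (3) if the ball $D_m$ is put into urn $x_n$ (with $n\ge1$), then $(m-1)k+1$ is a child of $n$. Thus $(S_0,0)$ is the component of $F$ containing $0$. The mapping $\Omega_{pk}:F\rightarrow((T,0),\mathcal C'_k)$ maps a $(p,k)$-forest $F$ to an increasing tree $(T,0)$ on $\{0,\dots,p\}$ and an associated colouring $\mathcal C'_k$ of its edges with the colour set $\{0,1,\dots,k-1\}$, constructed as follows. (1) For any $v>0$ such that $(v-1)k+1\in V(S_0)$, add an edge $\{0,v\}$ to $T$ and colour it $0$. (2) For $i>0$ and any vertex of the form $(v-1)k+1$ in $V(S_i)$, add an edge $\{i,v\}$ to $T$; if the vertex $(v-1)k+1$ has in $S_i$ an ancestor of the form $(i-1)k+r+1$ with $1\le r\le k-1$ (this ancestor is unique), colour the edge $\{i,v\}$ with colour $r$. *)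

theory Defs
  imports
    "HOL-Combinatorics.Stirling"
    "HOL-Computational_Algebra.Polynomial"
    "HOL-Library.FuncSet"
    "HOL-Library.Disjoint_Sets"
    Complex_Main
begin

section \<open>Normal ordering coefficients\<close>

text \<open>The operator \<open>x\<^sup>k D\<close>. Polynomials suffice to determine the coefficients of an
  operator of the form \<open>\<Sum> a\<^sub>m x\<^sup>m D\<^sup>m\<close>; see \<open>normal_ordering_unique\<close> below.\<close>

definition xkD :: "nat \<Rightarrow> real poly \<Rightarrow> real poly" where
  "xkD k f = monom 1 k * pderiv f"

definition is_normal_ordering :: "nat \<Rightarrow> nat \<Rightarrow> (nat \<Rightarrow> real) \<Rightarrow> bool" where
  "is_normal_ordering p k a \<longleftrightarrow>
     (\<forall>f. (xkD k ^^ p) f =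
        monom 1 (p * (k - 1)) * (\<Sum>m=1..p. smult (a m) (monom 1 m * (pderiv ^^ m) f)))"

text \<open>Outside \<open>1 \<le> m \<le> p\<close> the coefficients are set to \<open>0\<close> so that the description is definite.\<close>

definition alpha :: "nat \<Rightarrow> nat \<Rightarrow> nat \<Rightarrow> real" where
  "alpha p k = (THE a. is_normal_ordering p k a \<and> (\<forall>m. m \<notin> {1..p} \<longrightarrow> a m = 0))"

lemma xkD_monom_mult:
  assumes "k \<ge> 1"
  shows "xkD k (monom 1 n * g) =
    monom 1 (n + (k - 1)) * (smult (of_nat n) g + monom 1 1 * pderiv g)"
proof -
  have 1: "monom 1 k * pderiv (monom (1::real) n) = smult (of_nat n) (monom 1 (n + (k - 1)))"
    using assms by (cases n) (auto simp: pderiv_monom mult_monom smult_monom add.commute)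
  have 2: "monom (1::real) k = monom 1 (k - 1) * monom 1 1"
    using assms by (simp add: mult_monom)
  have "xkD k (monom 1 n * g) =
      g * (monom 1 k * pderiv (monom 1 n)) + monom 1 n * (monom 1 k * pderiv g)"
    by (simp add: xkD_def pderiv_mult algebra_simps)
  also have "monom 1 n * (monom 1 k * pderiv g) =
      monom 1 (n + (k - 1)) * (monom 1 1 * pderiv g)"
    unfolding 2 by (simp add: mult_monom mult.assoc[symmetric])
  finally show ?thesis
    unfolding 1 by (simp add: algebra_simps)
qed

lemma xkD_add: "xkD k (f + g) = xkD k f + xkD k g"
  by (simp add: xkD_def pderiv_add algebra_simps)

lemma xkD_smult: "xkD k (smult c f) = smult c (xkD k f)"
  by (simp add: xkD_def pderiv_smult)

lemma xkD_sum: "xkD k (sum f A) = (\<Sum>i\<in>A. xkD k (f i))"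
  by (induction A rule: infinite_finite_induct) (auto simp: xkD_add, auto simp: xkD_def)

lemma is_normal_ordering_Suc:
  assumes "k \<ge> 1" "is_normal_ordering p k a" "a 0 = 0" "a (Suc p) = 0"
  defines "b \<equiv> \<lambda>m. (of_nat (p * (k - 1) + m)) * a m + (if m = 0 then 0 else a (m - 1))"
  shows "is_normal_ordering (Suc p) k b"
  unfolding is_normal_ordering_def
proof
  fix f :: "real poly"
  let ?q = "p * (k - 1)"
  define M where "M = (\<lambda>m. monom 1 m * (pderiv ^^ m) f)"
  have "(xkD k ^^ Suc p) f = xkD k (monom 1 ?q * (\<Sum>m=1..p. smult (a m) (M m)))"
    using assms(2) by (simp add: is_normal_ordering_def M_def)
  also have "monom 1 ?q * (\<Sum>m=1..p. smult (a m) (M m)) =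
      (\<Sum>m=1..p. smult (a m) (monom 1 (?q + m) * (pderiv ^^ m) f))"
    by (simp add: M_def sum_distrib_left mult_monom mult.assoc[symmetric])
  also have "xkD k \<dots> = (\<Sum>m=1..p. smult (a m) (monom 1 (?q + m + (k - 1)) *
      (smult (of_nat (?q + m)) ((pderiv ^^ m) f) + monom 1 1 * (pderiv ^^ Suc m) f)))"
    by (simp only: xkD_sum xkD_smult xkD_monom_mult[OF assms(1)] funpow.simps o_apply)
  also have "\<dots> = (\<Sum>m=1..p. monom 1 (Suc p * (k - 1)) *
      (smult (of_nat (?q + m) * a m) (M m) + smult (a m) (M (Suc m))))"
  proof (rule sum.cong[OF refl])
    fix m
    have generic: "smult a (P * Q * (smult c g + R)) =
        P * (smult (c * a) (Q * g) + smult a (Q * R))" for a c :: real and P Q R g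
      by (simp add: algebra_simps smult_add_right)
    have "monom (1::real) (?q + m + (k - 1)) = monom 1 (Suc p * (k - 1)) * monom 1 m"
      by (simp only: mult_monom mult_Suc add_ac) simp
    moreover have "M m = monom 1 m * (pderiv ^^ m) f"
      by (simp add: M_def)
    moreover have "M (Suc m) = monom 1 m * (monom 1 1 * (pderiv ^^ Suc m) f)"
      by (simp add: M_def mult_monom mult.assoc[symmetric])
    ultimately show "smult (a m) (monom 1 (?q + m + (k - 1)) *
      (smult (of_nat (?q + m)) ((pderiv ^^ m) f) + monom 1 1 * (pderiv ^^ Suc m) f)) =
      monom 1 (Suc p * (k - 1)) *
      (smult (of_nat (?q + m) * a m) (M m) + smult (a m) (M (Suc m)))"
      using generic by (simp only:)
  qed
  also have "\<dots> = monom 1 (Suc p * (k - 1)) *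
      ((\<Sum>m=1..p. smult (of_nat (?q + m) * a m) (M m)) + (\<Sum>m=1..p. smult (a m) (M (Suc m))))"
    by (simp only: sum_distrib_left[symmetric] sum.distrib)
  also have "(\<Sum>m=1..p. smult (a m) (M (Suc m))) = (\<Sum>m=1..Suc p. smult (a (m - 1)) (M m))"
  proof -
    have "(\<Sum>m=1..Suc p. smult (a (m - 1)) (M m)) = (\<Sum>m=0..p. smult (a m) (M (Suc m)))"
      using sum.shift_bounds_cl_Suc_ivl[of "\<lambda>m. smult (a (m - 1)) (M m)" 0 p] by simp
    also have "\<dots> = (\<Sum>m=1..p. smult (a m) (M (Suc m)))"
      using assms(3) by (simp add: sum.atLeast_Suc_atMost)
    finally show ?thesis by simp
  qed
  also have "(\<Sum>m=1..p. smult (of_nat (?q + m) * a m) (M m)) =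
      (\<Sum>m=1..Suc p. smult (of_nat (?q + m) * a m) (M m))"
    using assms(4) by simp
  also have "(\<Sum>m=1..Suc p. smult (of_nat (?q + m) * a m) (M m)) +
      (\<Sum>m=1..Suc p. smult (a (m - 1)) (M m)) = (\<Sum>m=1..Suc p. smult (b m) (M m))"
    unfolding sum.distrib[symmetric]
    by (rule sum.cong) (auto simp: b_def smult_add_left)
  finally show "(xkD k ^^ Suc p) f = monom 1 (Suc p * (k - 1)) *
      (\<Sum>m=1..Suc p. smult (b m) (monom 1 m * (pderiv ^^ m) f))"
    by (simp only: M_def)
qed

lemma normal_ordering_exists:
  assumes "p \<ge> 1" "k \<ge> 1"
  shows "\<exists>a. is_normal_ordering p k a \<and> (\<forall>m. m \<notin> {1..p} \<longrightarrow> a m = 0)"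
  using assms(1)
proof (induction p rule: dec_induct)
  case base
  have "is_normal_ordering 1 k (\<lambda>m. if m = 1 then 1 else 0)"
    using assms(2)
    by (simp add: is_normal_ordering_def xkD_def mult_monom mult.assoc[symmetric])
  then show ?case
    by (intro exI[of _ "\<lambda>m. if m = 1 then 1 else 0"]) auto
next
  case (step p)
  then obtain a where a: "is_normal_ordering p k a" "\<And>m. m \<notin> {1..p} \<Longrightarrow> a m = 0"
    by blast
  have "is_normal_ordering (Suc p) k
      (\<lambda>m. of_nat (p * (k - 1) + m) * a m + (if m = 0 then 0 else a (m - 1)))"
    by (rule is_normal_ordering_Suc) (use assms a in auto)
  then show ?case
    by (intro exI[of _ "\<lambda>m. of_nat (p * (k - 1) + m) * a m + (if m = 0 then 0 else a (m - 1))"])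
       (use a in \<open>auto intro!: a(2)\<close>)
qed

lemma higher_pderiv_monom_self: "(pderiv ^^ n) (monom (c::real) n) = [:fact n * c:]"
proof (induction n arbitrary: c)
  case (Suc n)
  show ?case
    unfolding funpow_Suc_right o_apply
    by (simp add: pderiv_monom Suc.IH algebra_simps del: funpow.simps of_nat_Suc)
qed (simp add: monom_0)

lemma higher_pderiv_monom_less:
  assumes "n < m"
  shows "(pderiv ^^ m) (monom (c::real) n) = 0"
proof -
  have "(pderiv ^^ j) (0 :: real poly) = 0" for j
    by (induction j) auto
  moreover have "m = (m - Suc n) + Suc n"
    using assms by simp
  then have "(pderiv ^^ m) (monom c n) = (pderiv ^^ (m - Suc n)) (pderiv ((pderiv ^^ n) (monom c n)))"
    by (metis funpow.simps(2) funpow_add o_apply)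
  ultimately show ?thesis
    by (simp add: higher_pderiv_monom_self pderiv_pCons)
qed

lemma normal_ordering_unique:
  assumes "is_normal_ordering p k a" "is_normal_ordering p k b" "m \<in> {1..p}"
  shows "a m = b m"
  using assms(3)
proof (induction m rule: less_induct)
  case (less n)
  define g where "g = (\<lambda>c m. smult (c m) (monom 1 m * (pderiv ^^ m) (monom (1::real) n)))"
  have sum_split: "sum (g c) {1..p} = sum (g c) {1..<n} + smult (c n) (monom (fact n) n)" for c
  proof -
    have "sum (g c) {1..p} = sum (g c) {1..n}"
      by (rule sum.mono_neutral_right)
         (use less.prems in \<open>auto simp: g_def higher_pderiv_monom_less\<close>)
    also have "{1..n} = insert n {1..<n}"
      using less.prems by auto
    finally show ?thesis
      by (simp add: g_def higher_pderiv_monom_self smult_monom mult.commute[of "monom _ _"])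
  qed
  have "monom 1 (p * (k - 1)) * sum (g a) {1..p} = monom 1 (p * (k - 1)) * sum (g b) {1..p}"
    using assms(1,2) unfolding is_normal_ordering_def g_def by metis
  then have "sum (g a) {1..p} = sum (g b) {1..p}"
    by simp
  moreover have "sum (g a) {1..<n} = sum (g b) {1..<n}"
    by (rule sum.cong) (use less in \<open>auto simp: g_def\<close>)
  ultimately have "smult (a n) (monom (fact n) n) = smult (b n) (monom (fact n :: real) n)"
    unfolding sum_split by simp
  then show ?case
    by (simp add: smult_monom)
qed

lemma alpha_unique_ex:
  assumes "p \<ge> 1" "k \<ge> 1"
  shows "\<exists>!a. is_normal_ordering p k a \<and> (\<forall>m. m \<notin> {1..p} \<longrightarrow> a m = 0)"
proof (rule ex_ex1I)
  fix a b
  assume "is_normal_ordering p k a \<and> (\<forall>m. m \<notin> {1..p} \<longrightarrow> a m = 0)"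
    and "is_normal_ordering p k b \<and> (\<forall>m. m \<notin> {1..p} \<longrightarrow> b m = 0)"
  then show "a = b"
    using normal_ordering_unique[of p k a b] by (intro ext) metis
qed (fact normal_ordering_exists[OF assms])

lemma is_normal_ordering_alpha:
  assumes "p \<ge> 1" "k \<ge> 1"
  shows "is_normal_ordering p k (alpha p k)"
  unfolding alpha_def using theI'[OF alpha_unique_ex[OF assms]] by blast


section \<open>Distributions\<close>

text \<open>\<open>d i = j\<close> means that ball \<open>D\<^sub>i\<close> is put into urn \<open>x\<^sub>j\<close>.\<close>

definition distributions :: "nat \<Rightarrow> nat \<Rightarrow> (nat \<Rightarrow> nat) set" where
  "distributions p k = {d \<in> {1..p} \<rightarrow>\<^sub>E {0..p * k}.
     (\<forall>j\<in>{1..p * k}. card {i \<in> {1..p}. d i = j} \<le> 1) \<and>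
     (\<forall>i\<in>{1..p}. \<lceil>real (d i) / real k\<rceil> < int i)}"


section \<open>Increasing trees\<close>

datatype 'a graph = Graph (verts: "'a set") (edges: "'a set set")

definition simple_graph :: "'a graph \<Rightarrow> bool" where
  "simple_graph G \<longleftrightarrow> finite (verts G) \<and> (\<forall>e\<in>edges G. e \<subseteq> verts G \<and> card e = 2)"

definition is_path :: "'a graph \<Rightarrow> 'a list \<Rightarrow> bool" where
  "is_path G xs \<longleftrightarrow> xs \<noteq> [] \<and> distinct xs \<and> set xs \<subseteq> verts G \<and>
     (\<forall>i. Suc i < length xs \<longrightarrow> {xs ! i, xs ! Suc i} \<in> edges G)"

definition path_between :: "'a graph \<Rightarrow> 'a \<Rightarrow> 'a list \<Rightarrow> 'a \<Rightarrow> bool" where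
  "path_between G u xs v \<longleftrightarrow> is_path G xs \<and> hd xs = u \<and> last xs = v"

definition is_cycle :: "'a graph \<Rightarrow> 'a list \<Rightarrow> bool" where
  "is_cycle G xs \<longleftrightarrow> is_path G xs \<and> length xs \<ge> 3 \<and> {last xs, hd xs} \<in> edges G"

definition is_tree :: "'a graph \<Rightarrow> bool" where
  "is_tree G \<longleftrightarrow> simple_graph G \<and> verts G \<noteq> {} \<and>
     (\<forall>u\<in>verts G. \<forall>v\<in>verts G. \<exists>xs. path_between G u xs v) \<and>
     (\<nexists>xs. is_cycle G xs)"

definition increasing_tree :: "'a::linorder set \<Rightarrow> 'a graph \<Rightarrow> bool" where
  "increasing_tree V T \<longleftrightarrow> is_tree T \<and> verts T = V \<and>
     (\<forall>v xs. path_between T (Min V) xs v \<longrightarrow> sorted_wrt (<) xs)"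

definition children :: "'a graph \<Rightarrow> 'a \<Rightarrow> 'a \<Rightarrow> 'a set" where
  "children T r v = {w. \<exists>xs. path_between T r (xs @ [v, w]) w}"

definition ancestor :: "'a graph \<Rightarrow> 'a \<Rightarrow> 'a \<Rightarrow> 'a \<Rightarrow> bool" where
  "ancestor T r u w \<longleftrightarrow> (\<exists>xs. path_between T r xs w \<and> u \<in> set (butlast xs))"

definition starlike :: "'a graph \<Rightarrow> 'a \<Rightarrow> bool" where
  "starlike T r \<longleftrightarrow> (\<forall>v\<in>verts T. v \<noteq> r \<longrightarrow> card (children T r v) \<le> 1)"

definition component :: "'a graph \<Rightarrow> 'a \<Rightarrow> 'a graph" where
  "component G u = (let W = {w. \<exists>xs. path_between G u xs w} in
     Graph W {e \<in> edges G. e \<subseteq> W})"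


section \<open>Forests\<close>

text \<open>The symbol \<open>r\<^sub>i\<close> (\<open>i \<ge> 1\<close>) is encoded as the integer \<open>- i\<close>, so that it is smaller than every
  positive integer; \<open>rt 0 = 0\<close> is the root of \<open>S\<^sub>0\<close>. The vertex \<open>ball_vertex k m\<close> is
  \<open>(m - 1) k + 1\<close>, the one that represents the ball \<open>D\<^sub>m\<close> (\<open>m \<ge> 1\<close>).\<close>

definition rt :: "nat \<Rightarrow> int" where
  "rt i = - int i"

definition ball_vertex :: "nat \<Rightarrow> nat \<Rightarrow> int" where
  "ball_vertex k m = (int m - 1) * int k + 1"

definition subtree :: "int graph \<Rightarrow> nat \<Rightarrow> int graph" where
  "subtree F i = component F (rt i)"

definition forest_of :: "nat \<Rightarrow> nat \<Rightarrow> (nat \<Rightarrow> nat) \<Rightarrow> int graph \<Rightarrow> bool" where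
  "forest_of p k d F \<longleftrightarrow>
     verts F = {0..(int p - 1) * int k + 1} \<union> rt ` {1..p - 1} \<and>
     verts F = (\<Union>i\<in>{0..p - 1}. verts (subtree F i)) \<and>
     edges F = (\<Union>i\<in>{0..p - 1}. edges (subtree F i)) \<and>
     disjoint_family_on (\<lambda>i. verts (subtree F i)) {0..p - 1} \<and>
     (\<forall>i\<in>{0..p - 1}. rt i = Min (verts (subtree F i)) \<and>
        increasing_tree (verts (subtree F i)) (subtree F i) \<and> starlike (subtree F i) (rt i)) \<and>
     (\<forall>i\<in>{1..p - 1}. children (subtree F i) (rt i) (rt i) =
        {(int i - 1) * int k + 2..int i * int k}) \<and>
     (\<forall>m\<in>{1..p}. d m = 0 \<longrightarrow> ball_vertex k m \<in> children (subtree F 0) 0 0) \<and>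
     (\<forall>m\<in>{1..p}. d m \<ge> 1 \<longrightarrow>
        (\<exists>i\<in>{0..p - 1}. ball_vertex k m \<in> children (subtree F i) (rt i) (int (d m))))"

definition pk_forests :: "nat \<Rightarrow> nat \<Rightarrow> int graph set" where
  "pk_forests p k = {F. \<exists>d\<in>distributions p k. forest_of p k d F}"


section \<open>The mappings\<close>

text \<open>\<open>omega_edge p k F e c\<close>: the construction adds the edge \<open>e\<close> and gives it the colour \<open>c\<close>.\<close>

inductive omega_edge :: "nat \<Rightarrow> nat \<Rightarrow> int graph \<Rightarrow> nat set \<Rightarrow> nat \<Rightarrow> bool"
  for p k :: nat and F :: "int graph" where
  root: "v > 0 \<Longrightarrow> ball_vertex k v \<in> verts (subtree F 0) \<Longrightarrow> omega_edge p k F {0, v} 0"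
| inner: "i \<in> {1..p - 1} \<Longrightarrow> v > 0 \<Longrightarrow> ball_vertex k v \<in> verts (subtree F i) \<Longrightarrow>
    r \<in> {1..k - 1} \<Longrightarrow>
    ancestor (subtree F i) (rt i) ((int i - 1) * int k + int r + 1) (ball_vertex k v) \<Longrightarrow>
    omega_edge p k F {i, v} r"

definition omega_tree :: "nat \<Rightarrow> nat \<Rightarrow> int graph \<Rightarrow> nat graph" where
  "omega_tree p k F = Graph {0..p}
     ({{0, v} |v. v > 0 \<and> ball_vertex k v \<in> verts (subtree F 0)} \<union>
      {{i, v} |i v. i \<in> {1..p - 1} \<and> v > 0 \<and> ball_vertex k v \<in> verts (subtree F i)})"

definition Omega :: "nat \<Rightarrow> nat \<Rightarrow> int graph \<Rightarrow> nat graph \<times> (nat set \<Rightarrow> nat)" where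
  "Omega p k F = (omega_tree p k F,
     restrict (\<lambda>e. THE c. omega_edge p k F e c) (edges (omega_tree p k F)))"

definition Xi :: "nat \<Rightarrow> nat \<Rightarrow> int graph \<Rightarrow> (nat graph \<times> (nat set \<Rightarrow> nat)) \<times> int graph" where
  "Xi p k F = (Omega p k F, subtree F 0)"

text \<open>The colourings have the form produced by \<open>Omega\<close>: colour \<open>0\<close> is used exactly on the edges
  at the root, and every other edge carries one of the remaining \<open>k - 1\<close> colours.\<close>

definition colourings :: "nat \<Rightarrow> nat graph \<Rightarrow> (nat set \<Rightarrow> nat) set" where
  "colourings k T = {C \<in> edges T \<rightarrow>\<^sub>E {0..<k}. \<forall>e\<in>edges T. C e = 0 \<longleftrightarrow> 0 \<in> e}"

text \<open>The vertex set of \<open>S\<^sub>0\<close> is determined by the neighbours of the root in \<open>T\<close>.\<close>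

definition triples :: "nat \<Rightarrow> nat \<Rightarrow> ((nat graph \<times> (nat set \<Rightarrow> nat)) \<times> int graph) set" where
  "triples p k = {((T, C), S). increasing_tree {0..p} T \<and> C \<in> colourings k T \<and>
     increasing_tree ({0} \<union> {ball_vertex k v |v. {0, v} \<in> edges T}) S \<and> starlike S 0}"

end

theory Submission
  imports Defs
begin

text \<open>An increasing tree is the same as a function assigning to every vertex but the minimum a smaller
  parent. In a \<open>(p,k)\<close>-forest every positive vertex is either some \<open>(m - 1) k + 1\<close>, whose parent is the
  urn of \<open>D\<^sub>m\<close>, or a child of some \<open>r\<^sub>i\<close>; hence forests and distributions are the same thing.

  \<open>\<Xi>\<close> is injective: \<open>S\<^sub>0\<close> is part of the image, and every other path hanging below a child of
  some \<open>r\<^sub>i\<close> is increasing, so it is determined by its vertex set, which is read off \<open>T\<close> and the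
  colouring. Surjectivity needs no explicit inverse. Forests with \<open>m\<close> children of \<open>0\<close> obey the
  recurrence \<open>a\<^sub>p\<^sub>+\<^sub>1(m) = (p (k - 1) + m) a\<^sub>p(m) + a\<^sub>p(m - 1)\<close> by inserting the last ball. Triples are
  counted by \<open>\<Sum>\<^sub>j [p,j] {j,m} (k - 1)\<^bsup>p-j\<^esup>\<close>: choose \<open>T\<close> with \<open>j\<close> children of the root, colour
  its \<open>p - j\<close> other edges, choose \<open>S\<^sub>0\<close>. This sum satisfies the same recurrence, so both finite sets
  have the same size. The coefficients of the normal ordering satisfy it as well.\<close>

section \<open>Increasing trees as parent functions\<close>

text \<open>The condition on urns amounts to \<open>d m \<le> (m - 1) * k\<close>, that is,
  \<open>d m < ball_vertex k m\<close>. So an urn is permitted exactly when the parent it prescribes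
  is smaller than the child, and one ball per urn is starlikeness. The vertex
  \<open>ball_vertex k m\<close> stands for a ball and for an urn at once, and every urn that can be
  used occurs as a vertex.

  For \<open>i \<ge> 1\<close> the tree at \<open>rt i\<close> consists of \<open>k - 1\<close>
  paths, one below each child of the root, and the colour of an edge of \<open>T\<close> names the
  path on which a ball lies. The tree at \<open>0\<close> has no prescribed number of paths and all
  its balls get colour \<open>0\<close>, which is why it must be kept as a third component.

  The factor \<open>p * (k - 1) + m\<close> counts free urns: the last of \<open>p + 1\<close> balls
  has \<open>p * k\<close> urns besides urn \<open>0\<close>, and \<open>p - m\<close> of them are
  taken if \<open>m\<close> earlier balls lie in urn \<open>0\<close>. \<open>Xi\<close> preserves
  the number \<open>m\<close> of children of \<open>0\<close>, so the counts can be compared for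
  each \<open>m\<close> and the resulting bijections glued.\<close>

lemma is_path_iff_successively:
  "is_path G xs \<longleftrightarrow> xs \<noteq> [] \<and> distinct xs \<and> set xs \<subseteq> verts G \<and>
     successively (\<lambda>a b. {a, b} \<in> edges G) xs"
  by (auto simp: is_path_def successively_conv_nth)

lemma path_between_if_connected:
  assumes "(\<lambda>a b. a \<in> verts G \<and> b \<in> verts G \<and> {a, b} \<in> edges G)\<^sup>*\<^sup>* u v" "u \<in> verts G"
  shows "\<exists>xs. path_between G u xs v"
  using assms(1)
proof (induction rule: rtranclp_induct)
  case base
  have "path_between G u [u] u"
    using assms(2) by (simp add: path_between_def is_path_iff_successively)
  then show ?case ..
next
  case (step v w)
  then obtain xs where xs: "path_between G u xs v"
    by blast
  show ?case
  proof (cases "w \<in> set xs")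
    case True
    \<comment> \<open>Paths must not repeat vertices; when the walk comes back to \<open>w\<close>,
      the path is cut at \<open>w\<close>.\<close>
    then obtain ys zs where "xs = ys @ w # zs"
      by (meson split_list)
    with xs have "path_between G u (ys @ [w]) w"
      by (auto simp: path_between_def is_path_iff_successively successively_append_iff hd_append
          split: if_splits)
    then show ?thesis ..
  next
    case False
    with xs step have "path_between G u (xs @ [w]) w"
      by (auto simp: path_between_def is_path_iff_successively successively_append_iff)
    then show ?thesis ..
  qed
qed

text \<open>\<open>R\<close> is the set of roots. Only the values of \<open>f\<close> on
  \<open>V - R\<close> count, so the same \<open>f\<close> serves a forest and each of its
  components.\<close>

definition parent_graph :: "'a set \<Rightarrow> 'a set \<Rightarrow> ('a \<Rightarrow> 'a) \<Rightarrow> 'a graph" where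
  "parent_graph V R f = Graph V ((\<lambda>v. {f v, v}) ` (V - R))"

lemma verts_parent_graph [simp]: "verts (parent_graph V R f) = V"
  and edges_parent_graph: "edges (parent_graph V R f) = (\<lambda>v. {f v, v}) ` (V - R)"
  by (simp_all add: parent_graph_def)

lemma parent_graph_cong:
  "(\<And>v. v \<in> V - R \<Longrightarrow> f v = g v) \<Longrightarrow> parent_graph V R f = parent_graph V R g"
  by (auto simp: parent_graph_def)

section \<open>Forests in which every parent is smaller than its child\<close>

locale parent_forest =
  fixes V R :: "'a::linorder set" and f :: "'a \<Rightarrow> 'a"
  assumes finite_V: "finite V"
    and roots: "R \<subseteq> V"
    and parent_in: "v \<in> V - R \<Longrightarrow> f v \<in> V"
    and parent_less: "v \<in> V - R \<Longrightarrow> f v < v"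
begin

abbreviation G :: "'a graph" where
  "G \<equiv> parent_graph V R f"

definition step :: "'a \<Rightarrow> 'a \<Rightarrow> bool" where
  "step u w \<longleftrightarrow> w \<in> V - R \<and> u = f w"

abbreviation comp :: "'a \<Rightarrow> 'a set" where
  "comp r \<equiv> {w. step\<^sup>*\<^sup>* r w}"

lemma stepD:
  assumes "step u w"
  shows "u \<in> V" "w \<in> V" "w \<notin> R" "u < w" "f w = u" "{u, w} \<in> edges G"
  using assms parent_in parent_less by (auto simp: step_def edges_parent_graph)

text \<open>Parents are smaller, so the order recovers the orientation of an undirected edge: its
  larger endpoint is the child.\<close>

lemma edge_iff:
  assumes "u < w"
  shows "{u, w} \<in> edges G \<longleftrightarrow> w \<in> V - R \<and> u = f w"
  using assms parent_less by (fastforce simp: edges_parent_graph doubleton_eq_iff)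

lemma simple_graph: "simple_graph G"
  unfolding simple_graph_def edges_parent_graph
  using finite_V parent_in parent_less by (fastforce simp: card_2_iff)

lemma reach_le: "step\<^sup>*\<^sup>* u w \<Longrightarrow> u \<le> w"
  by (induction rule: rtranclp_induct) (auto dest: stepD)

lemma reach_less: "step\<^sup>+\<^sup>+ u w \<Longrightarrow> u < w"
  by (induction rule: tranclp_induct) (auto dest: stepD)

lemma reach_in: "step\<^sup>*\<^sup>* u w \<Longrightarrow> u \<in> V \<Longrightarrow> w \<in> V"
  by (induction rule: rtranclp_induct) (auto dest: stepD)

lemma reach_root: "step\<^sup>*\<^sup>* u w \<Longrightarrow> w \<in> R \<Longrightarrow> u = w"
  by (metis rtranclp.cases stepD(3))

text \<open>Every vertex has at most one parent, so the ancestors of \<open>w\<close> form a single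
  path and any two of them are comparable.\<close>

lemma reach_linear:
  assumes "step\<^sup>*\<^sup>* a w" "step\<^sup>*\<^sup>* b w"
  shows "step\<^sup>*\<^sup>* a b \<or> step\<^sup>*\<^sup>* b a"
  using assms
proof (induction arbitrary: b rule: rtranclp_induct)
  case (step y z)
  from step.prems show ?case
  proof (cases rule: rtranclp.cases)
    case rtrancl_refl
    then show ?thesis
      using step by (meson rtranclp.rtrancl_into_rtrancl)
  next
    case (rtrancl_into_rtrancl y')
    then have "y' = y"
      using step by (auto simp: step_def)
    then show ?thesis
      using step rtrancl_into_rtrancl by blast
  qed
qed auto

lemma successively_step_sorted:
  assumes "successively step xs"
  shows "sorted_wrt (<) xs"
proof -
  have "successively (<) xs"
    by (rule successively_mono[OF assms]) (auto dest: stepD)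
  then show ?thesis
    by (subst (asm) successively_conv_sorted_wrt) (auto simp: transp_def)
qed

text \<open>The first step must go down, since a root has no parent. Later on the only way up leads
  back to the vertex just left, which a path without repetitions cannot visit again.\<close>

lemma is_path_from_root_imp:
  assumes "is_path G xs" "hd xs \<in> R"
  shows "successively step xs"
  using assms
proof (induction xs rule: rev_induct)
  case (snoc w xs)
  show ?case
  proof (cases "xs = []")
    case False
    with snoc have IH: "successively step xs" and w: "w \<notin> set xs" and e: "{last xs, w} \<in> edges G"
      by (auto simp: is_path_iff_successively successively_append_iff)
    have "step (last xs) w"
    proof (rule ccontr)
      assume neg: "\<not> step (last xs) w"
      from e obtain v where "v \<in> V - R" "{last xs, w} = {f v, v}"
        by (auto simp: edges_parent_graph)
      then have l: "last xs \<in> V - R" "w = f (last xs)"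
        using neg by (auto simp: step_def doubleton_eq_iff)
      obtain ys v where xs: "xs = ys @ [v]"
        using False by (metis rev_exhaust)
      show False
      proof (cases "ys = []")
        case True
        with xs l snoc.prems show False by auto
      next
        case False
        with IH xs have "step (last ys) v"
          by (auto simp: successively_append_iff)
        with l xs have "w = last ys"
          by (auto simp: step_def)
        with w xs False show False by auto
      qed
    qed
    with IH show ?thesis
      by (auto simp: successively_append_iff)
  qed auto
qed auto

lemma is_path_if_successively_step:
  assumes "successively step xs" "xs \<noteq> []" "hd xs \<in> V"
  shows "is_path G xs"
proof -
  have "set xs \<subseteq> V"
    using assms
  proof (induction xs rule: rev_induct)
    case (snoc w xs)
    then show ?case
      by (cases "xs = []") (auto simp: successively_append_iff dest: stepD)
  qed auto
  moreover have "distinct xs"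
    using successively_step_sorted[OF assms(1)] by (simp add: strict_sorted_iff)
  moreover have "successively (\<lambda>a b. {a, b} \<in> edges G) xs"
    by (rule successively_mono[OF assms(1)]) (rule stepD)
  ultimately show ?thesis
    using assms(2) by (simp add: is_path_iff_successively)
qed

lemma path_from_root_iff:
  assumes "r \<in> R"
  shows "path_between G r xs w \<longleftrightarrow> xs \<noteq> [] \<and> hd xs = r \<and> last xs = w \<and> successively step xs"
  unfolding path_between_def
  using assms roots is_path_from_root_imp is_path_if_successively_step
  by (metis is_path_def subsetD)

lemma reach_iff_successively:
  "step\<^sup>*\<^sup>* u w \<longleftrightarrow> (\<exists>xs. xs \<noteq> [] \<and> hd xs = u \<and> last xs = w \<and> successively step xs)"
proof
  assume "step\<^sup>*\<^sup>* u w"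
  then show "\<exists>xs. xs \<noteq> [] \<and> hd xs = u \<and> last xs = w \<and> successively step xs"
  proof (induction rule: rtranclp_induct)
    case base
    show ?case by (intro exI[of _ "[u]"]) auto
  next
    case (step y z)
    then obtain xs where "xs \<noteq> [] \<and> hd xs = u \<and> last xs = y \<and> successively step xs"
      by blast
    with step show ?case
      by (intro exI[of _ "xs @ [z]"]) (auto simp: successively_append_iff)
  qed
next
  assume "\<exists>xs. xs \<noteq> [] \<and> hd xs = u \<and> last xs = w \<and> successively step xs"
  then obtain xs where "xs \<noteq> []" "hd xs = u" "last xs = w" "successively step xs"
    by blast
  then show "step\<^sup>*\<^sup>* u w"
  proof (induction xs arbitrary: w rule: rev_induct)
    case (snoc z xs)
    then show ?case
      by (cases "xs = []") (auto simp: successively_append_iff intro: rtranclp.rtrancl_into_rtrancl)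
  qed auto
qed

text \<open>Paths from a root only descend, so a component of the undirected graph is the set of
  descendants of its root. No other root occurs among them.\<close>

lemma component_root:
  assumes "r \<in> R"
  shows "component G r = parent_graph (comp r) {r} f"
proof -
  have W: "{w. \<exists>xs. path_between G r xs w} = comp r"
    using assms by (auto simp: path_from_root_iff reach_iff_successively)
  have E: "{e \<in> edges G. e \<subseteq> comp r} = (\<lambda>v. {f v, v}) ` (comp r - {r})"
  proof (intro equalityI subsetI)
    fix e assume "e \<in> {e \<in> edges G. e \<subseteq> comp r}"
    then show "e \<in> (\<lambda>v. {f v, v}) ` (comp r - {r})"
      using assms by (auto simp: edges_parent_graph)
  next
    fix e assume "e \<in> (\<lambda>v. {f v, v}) ` (comp r - {r})"
    then obtain v where v: "v \<noteq> r" "step\<^sup>*\<^sup>* r v" "e = {f v, v}"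
      by auto
    from v(2,1) have "v \<in> V - R \<and> step\<^sup>*\<^sup>* r (f v)"
      by (cases rule: rtranclp.cases) (auto simp: step_def)
    with v show "e \<in> {e \<in> edges G. e \<subseteq> comp r}"
      by (auto simp: edges_parent_graph)
  qed
  show ?thesis
    by (simp only: component_def Let_def W E) (simp add: parent_graph_def)
qed

lemma comp_parent_forest:
  assumes "r \<in> R"
  shows "parent_forest (comp r) {r} f"
proof
  have "comp r \<subseteq> V"
    using assms roots reach_in by auto
  then show "finite (comp r)"
    using finite_V finite_subset by blast
next
  fix v assume "v \<in> comp r - {r}"
  then have "step\<^sup>*\<^sup>* r v" "v \<noteq> r" by auto
  then have "v \<in> V - R \<and> step\<^sup>*\<^sup>* r (f v)"
    by (cases rule: rtranclp.cases) (auto simp: step_def)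
  then show "f v \<in> comp r" "f v < v"
    using parent_less by auto
qed auto

lemma Min_comp_root:
  assumes "r \<in> R"
  shows "Min (comp r) = r"
  using parent_forest.finite_V[OF comp_parent_forest[OF assms]]
  by (intro Min_eqI) (auto dest: reach_le)

lemma ex_root:
  assumes "v \<in> V"
  shows "\<exists>r\<in>R. step\<^sup>*\<^sup>* r v"
  using assms
\<comment> \<open>The order on the type need not be well-founded, so the number of smaller vertices
  is the measure.\<close>
proof (induction "card {u \<in> V. u < v}" arbitrary: v rule: less_induct)
  case less
  show ?case
  proof (cases "v \<in> R")
    case False
    then have v: "step (f v) v"
      using less.prems by (simp add: step_def)
    then have "{u \<in> V. u < f v} \<subset> {u \<in> V. u < v}"
      using stepD[OF v] by auto
    then have "card {u \<in> V. u < f v} < card {u \<in> V. u < v}"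
      using finite_V by (intro psubset_card_mono) auto
    then obtain r where "r \<in> R" "step\<^sup>*\<^sup>* r (f v)"
      using less.hyps stepD(1)[OF v] by blast
    with v show ?thesis
      by (meson rtranclp.rtrancl_into_rtrancl)
  qed auto
qed

lemma root_unique:
  assumes "step\<^sup>*\<^sup>* r v" "step\<^sup>*\<^sup>* r' v" "r \<in> R" "r' \<in> R"
  shows "r = r'"
  using reach_linear[OF assms(1,2)] assms(3,4) reach_root by auto

lemma children_root:
  assumes "r \<in> R"
  shows "children G r u = {w \<in> V - R. f w = u \<and> u \<in> comp r}"
proof (intro equalityI subsetI)
  fix w assume "w \<in> children G r u"
  then obtain xs where xs: "hd (xs @ [u, w]) = r" "successively step (xs @ [u, w])"
    using assms by (auto simp: children_def path_from_root_iff)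
  have "successively step ((xs @ [u]) @ [w])"
    using xs(2) by simp
  then have "successively step (xs @ [u])"
    unfolding successively_append_iff by blast
  moreover have "hd (xs @ [u]) = r"
    using xs(1) by (cases xs) auto
  ultimately have "step\<^sup>*\<^sup>* r u"
    unfolding reach_iff_successively by (intro exI[of _ "xs @ [u]"]) auto
  with xs(2) show "w \<in> {w \<in> V - R. f w = u \<and> u \<in> comp r}"
    by (auto simp: successively_append_iff step_def)
next
  fix w assume w: "w \<in> {w \<in> V - R. f w = u \<and> u \<in> comp r}"
  then obtain xs where xs: "xs \<noteq> []" "hd xs = r" "last xs = u" "successively step xs"
    by (auto simp: reach_iff_successively)
  then obtain ys where ys: "xs = ys @ [u]"
    by (metis append_butlast_last_id)
  have "path_between G r (xs @ [w]) w"
    using xs w unfolding path_from_root_iff[OF assms] successively_append_iff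
    by (simp add: step_def)
  then have "path_between G r (ys @ [u, w]) w"
    by (simp add: ys)
  then show "w \<in> children G r u"
    by (auto simp: children_def)
qed

lemma ancestor_root:
  assumes "r \<in> R"
  shows "ancestor G r u w \<longleftrightarrow> step\<^sup>*\<^sup>* r u \<and> step\<^sup>+\<^sup>+ u w"
proof
  assume "ancestor G r u w"
  then obtain xs where xs: "xs \<noteq> []" "hd xs = r" "last xs = w" "successively step xs"
    "u \<in> set (butlast xs)"
    using assms by (auto simp: ancestor_def path_from_root_iff)
  then obtain ys zs where "butlast xs = ys @ u # zs"
    by (meson split_list)
  then have split: "xs = (ys @ [u]) @ zs @ [w]"
    using xs by (metis append.assoc append_Cons append_Nil append_butlast_last_id)
  then have "successively step (ys @ [u])" "hd (ys @ [u]) = r"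
    using xs by (metis successively_append_iff, metis hd_append2 snoc_eq_iff_butlast)
  then have "step\<^sup>*\<^sup>* r u"
    unfolding reach_iff_successively by (intro exI[of _ "ys @ [u]"]) auto
  moreover have "step\<^sup>*\<^sup>* u w"
    unfolding reach_iff_successively
    using xs split by (intro exI[of _ "u # zs @ [w]"]) (auto simp: successively_append_iff)
  moreover have "u < w"
    using successively_step_sorted[OF xs(4)] unfolding split by (auto simp: sorted_wrt_append)
  ultimately show "step\<^sup>*\<^sup>* r u \<and> step\<^sup>+\<^sup>+ u w"
    by (metis less_irrefl rtranclpD)
next
  assume "step\<^sup>*\<^sup>* r u \<and> step\<^sup>+\<^sup>+ u w"
  then have "step\<^sup>*\<^sup>* r u" "step\<^sup>+\<^sup>+ u w"
    by auto
  then obtain y where y: "step u y" "step\<^sup>*\<^sup>* y w"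
    by (meson tranclpD)
  obtain xs where xs: "xs \<noteq> []" "hd xs = r" "last xs = u" "successively step xs"
    using \<open>step\<^sup>*\<^sup>* r u\<close> unfolding reach_iff_successively by blast
  obtain ys where ys: "ys \<noteq> []" "hd ys = y" "last ys = w" "successively step ys"
    using y unfolding reach_iff_successively by blast
  have "path_between G r (xs @ ys) w"
    using assms xs ys y by (auto simp: path_from_root_iff successively_append_iff)
  moreover have "u \<in> set (butlast (xs @ ys))"
    using xs ys by (auto simp: butlast_append)
  ultimately show "ancestor G r u w"
    unfolding ancestor_def by blast
qed

text \<open>\<open>omega_edge\<close> speaks of ancestors inside a component, whereas later
  arguments use \<open>step\<close> of the whole forest. The two relations agree at descendants of
  \<open>r\<close>.\<close>

lemma ancestor_component:
  assumes "r \<in> R"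
  shows "ancestor (component G r) r u w \<longleftrightarrow> step\<^sup>*\<^sup>* r u \<and> step\<^sup>+\<^sup>+ u w"
proof -
  interpret S: parent_forest "comp r" "{r}" f
    by (rule comp_parent_forest[OF assms])
  have le: "step x y" if "S.step x y" for x y
  proof -
    have "step\<^sup>*\<^sup>* r y" "y \<noteq> r" "x = f y"
      using that by (auto simp: S.step_def)
    then show ?thesis
      by (cases rule: rtranclp.cases) (auto simp: step_def)
  qed
  have ge: "S.step x y" if "step x y" "step\<^sup>*\<^sup>* r x" for x y
  proof -
    have "step\<^sup>*\<^sup>* r y"
      using that by simp
    moreover have "y \<noteq> r"
      using that(1) assms by (auto simp: step_def)
    ultimately show ?thesis
      using that(1) by (simp add: S.step_def step_def)
  qed
  have rtrancl_le: "step\<^sup>*\<^sup>* x y" if "S.step\<^sup>*\<^sup>* x y" for x y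
    using that by (induction rule: rtranclp_induct) (auto dest: le)
  have rtrancl_ge: "S.step\<^sup>*\<^sup>* x y" if "step\<^sup>*\<^sup>* x y" "step\<^sup>*\<^sup>* r x" for x y
    using that
  proof (induction rule: rtranclp_induct)
    case (step y z)
    then have "step\<^sup>*\<^sup>* r y"
      by (meson rtranclp_trans)
    with step ge show ?case
      by (meson rtranclp.rtrancl_into_rtrancl)
  qed simp
  have tr: "step\<^sup>+\<^sup>+ x y \<longleftrightarrow> step\<^sup>*\<^sup>* x y \<and> x \<noteq> y" for x y
    using reach_less rtranclpD[of step x y] by (auto simp: tranclp_into_rtranclp)
  have S_tr: "S.step\<^sup>+\<^sup>+ x y \<longleftrightarrow> S.step\<^sup>*\<^sup>* x y \<and> x \<noteq> y" for x y
    using S.reach_less rtranclpD[of S.step x y] by (auto simp: tranclp_into_rtranclp)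
  have S_iff: "S.step\<^sup>*\<^sup>* x y \<longleftrightarrow> step\<^sup>*\<^sup>* x y" if "step\<^sup>*\<^sup>* r x" for x y
    using rtrancl_le rtrancl_ge[OF _ that] by blast
  have "S.step\<^sup>*\<^sup>* r u \<and> S.step\<^sup>+\<^sup>+ u w \<longleftrightarrow> step\<^sup>*\<^sup>* r u \<and> step\<^sup>+\<^sup>+ u w"
    by (cases "step\<^sup>*\<^sup>* r u") (simp_all add: S_iff tr S_tr)
  then show ?thesis
    unfolding component_root[OF assms] by (subst S.ancestor_root) auto
qed

text \<open>The largest vertex of a cycle would have two different smaller neighbours, and both
  would be its parent.\<close>

lemma no_cycle: "\<not> is_cycle G xs"
proof
  assume cyc: "is_cycle G xs"
  define n where "n = length xs"
  have n: "n \<ge> 3" and dist: "distinct xs" and ne: "xs \<noteq> []"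
    using cyc by (auto simp: is_cycle_def is_path_def n_def)
  have edge: "{xs ! i, xs ! (Suc i mod n)} \<in> edges G" if "i < n" for i
  proof (cases "Suc i = n")
    case True
    then have "i = length xs - 1"
      by (simp add: n_def)
    then have "last xs = xs ! i" "hd xs = xs ! (Suc i mod n)"
      using ne n True by (auto simp: last_conv_nth hd_conv_nth n_def)
    then show ?thesis
      using cyc by (simp add: is_cycle_def)
  next
    case False
    then show ?thesis
      using cyc that by (auto simp: is_cycle_def is_path_def n_def)
  qed
  obtain i where i: "i < n" "xs ! i = Max (set xs)"
    using Max_in[of "set xs"] ne by (auto simp: in_set_conv_nth n_def)
  have below: "f (xs ! i) = xs ! j" if "j < n" "j \<noteq> i" "{xs ! j, xs ! i} \<in> edges G" for j
  proof -
    have "xs ! j \<noteq> xs ! i"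
      using nth_eq_iff_index_eq[OF dist] i(1) that(1,2) by (simp add: n_def)
    moreover have "xs ! j \<le> xs ! i"
      using i that by (simp add: n_def)
    ultimately have "xs ! j < xs ! i"
      by simp
    then show ?thesis
      using edge_iff that(3) by metis
  qed
  \<comment> \<open>The neighbours of position \<open>i\<close> on the cycle, with indices taken
    modulo \<open>n\<close>; they differ because \<open>n \<ge> 3\<close>.\<close>
  define j where "j = Suc i mod n"
  define l where "l = (if i = 0 then n - 1 else i - 1)"
  have "j < n" "l < n" "j \<noteq> i" "l \<noteq> i" "j \<noteq> l" and l: "Suc l mod n = i"
    using n i by (auto simp: j_def l_def mod_Suc)
  moreover have "{xs ! j, xs ! i} \<in> edges G"
    using edge[OF i(1)] by (simp add: j_def insert_commute)
  moreover have "{xs ! l, xs ! i} \<in> edges G"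
    using edge[OF \<open>l < n\<close>] l by simp
  ultimately have "xs ! j = xs ! l"
    using below by metis
  then show False
    using \<open>j \<noteq> l\<close> \<open>j < n\<close> \<open>l < n\<close> dist by (simp add: nth_eq_iff_index_eq n_def)
qed

end

text \<open>In either graph the parent of \<open>v\<close> is its only smaller neighbour.\<close>

lemma parent_graph_inject:
  assumes "parent_forest V R f" "parent_forest V R g"
    and "parent_graph V R f = parent_graph V R g" "v \<in> V - R"
  shows "f v = g v"
  using parent_forest.edge_iff[OF assms(1), of "f v" v] parent_forest.edge_iff[OF assms(2), of "f v" v]
    parent_forest.parent_less[OF assms(1,4)] assms(3,4) by auto

section \<open>A single root: increasing trees\<close>

locale parent_tree = parent_forest V "{r}" f for V :: "'a::linorder set" and r f
begin

lemma comp_eq: "comp r = V"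
  using ex_root reach_in roots by auto

lemma Min_eq: "Min V = r"
  using Min_comp_root[of r] comp_eq by simp

lemma children_eq: "children G r u = {w \<in> V - {r}. f w = u}"
proof -
  have "u \<in> comp r" if "w \<in> V - {r}" "f w = u" for w
    using that parent_in[of w] comp_eq by auto
  then show ?thesis
    unfolding children_root[of r, simplified] by auto
qed

lemma increasing: "increasing_tree V G"
  unfolding increasing_tree_def
proof (intro conjI allI impI)
  let ?adj = "\<lambda>a b. a \<in> verts G \<and> b \<in> verts G \<and> {a, b} \<in> edges G"
  have to_root: "?adj\<^sup>*\<^sup>* r v" if "v \<in> V" for v
  proof -
    have "step\<^sup>*\<^sup>* r v"
      using that comp_eq by auto
    then show ?thesis
      by (rule rtranclp_mono[THEN predicate2D, rotated]) (auto dest: stepD)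
  qed
  \<comment> \<open>Any two vertices are joined through the root: adjacency is symmetric, so the
    descent to \<open>u\<close> can be reversed.\<close>
  have "symp ?adj"
    by (auto simp: symp_def insert_commute)
  then have "symp ?adj\<^sup>*\<^sup>*"
    by (rule symp_rtranclp)
  then have "?adj\<^sup>*\<^sup>* u v" if "u \<in> V" "v \<in> V" for u v
    using to_root that by (meson rtranclp_trans sympD)
  then show "is_tree G"
    unfolding is_tree_def using simple_graph path_between_if_connected[of G] no_cycle roots
    by auto
next
  fix v xs assume "path_between G (Min V) xs v"
  then show "sorted_wrt (<) xs"
    by (auto simp: Min_eq path_from_root_iff intro: successively_step_sorted)
qed auto

text \<open>Having at most one child means that \<open>f\<close> is injective outside the fibre of
  the root. The capacity condition on urns takes the same form, see
  \<open>placements\<close>.\<close>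

lemma starlike_iff: "starlike G r \<longleftrightarrow> (\<forall>v\<in>V - {r}. \<forall>w\<in>V - {r}. f v = f w \<and> f v \<noteq> r \<longrightarrow> v = w)"
  (is "?L \<longleftrightarrow> ?R")
proof
  assume L: ?L
  show ?R
  proof (intro ballI impI)
    fix v w assume *: "v \<in> V - {r}" "w \<in> V - {r}" "f v = f w \<and> f v \<noteq> r"
    let ?A = "{w \<in> V - {r}. f w = f v}"
    have "card ?A \<le> 1"
      using L * parent_in[of v] by (auto simp: starlike_def children_eq)
    moreover have "finite ?A"
      using finite_V by simp
    ultimately have "\<forall>x\<in>?A. \<forall>y\<in>?A. x = y"
      using card_le_Suc0_iff_eq[of ?A] unfolding One_nat_def by blast
    moreover have "v \<in> ?A" "w \<in> ?A"
      using * by auto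
    ultimately show "v = w"
      by blast
  qed
next
  assume R: ?R
  have "card {w \<in> V - {r}. f w = v} \<le> 1" if "v \<noteq> r" for v
    unfolding One_nat_def
    by (subst card_le_Suc0_iff_eq) (use finite_V R that in auto)
  then show ?L
    by (simp add: starlike_def children_eq)
qed

end

text \<open>Two different increasing paths to \<open>w\<close> would close up to a cycle, so every \<open>w\<close> has at most one
  smaller neighbour.\<close>

lemma increasing_tree_parent:
  assumes "increasing_tree V T"
  obtains f where "parent_tree V (Min V) f" "T = parent_graph V {Min V} f"
proof -
  let ?r = "Min V"
  have tree: "is_tree T" and V: "verts T = V"
    and sorted: "\<And>v xs. path_between T ?r xs v \<Longrightarrow> sorted_wrt (<) xs"
    using assms by (auto simp: increasing_tree_def)
  have fin: "finite V" and ne: "V \<noteq> {}" and r: "?r \<in> V"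
    and simple: "\<And>e. e \<in> edges T \<Longrightarrow> e \<subseteq> V \<and> card e = 2"
    using tree V by (auto simp: is_tree_def simple_graph_def)
  have path: "\<exists>xs. path_between T ?r xs v" if "v \<in> V" for v
    using tree that r V unfolding is_tree_def by blast
  have uniq: "u = u'"
    if P: "path_between T ?r (P @ [w]) w" "P \<noteq> []" "last P = u"
    and Q: "path_between T ?r (Q @ [w]) w" "Q \<noteq> []" "last Q = u'" for P Q u u' w
  proof (rule ccontr)
    assume "u \<noteq> u'"
    have "hd P = ?r" "hd Q = ?r"
      using P Q by (auto simp: path_between_def)
    then have "\<exists>x\<in>set P. x \<in> set Q"
      using P(2) Q(2) by (metis hd_in_set)
    \<comment> \<open>\<open>z\<close> is the last vertex of \<open>P\<close> that also lies on
      \<open>Q\<close>. Behind it the two paths are disjoint up to \<open>w\<close>, so they close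
      up to a cycle.\<close>
    then obtain P1 z P2 where P12: "P = P1 @ z # P2" "z \<in> set Q" "\<forall>x\<in>set P2. x \<notin> set Q"
      using split_list_last_prop[of P "\<lambda>x. x \<in> set Q"] by blast
    then obtain Q1 Q2 where Q12: "Q = Q1 @ z # Q2"
      by (meson split_list)
    define C where "C = z # P2 @ w # rev Q2"
    \<comment> \<open>If both remainders were empty, \<open>P\<close> and \<open>Q\<close> would
      both end in \<open>z\<close>, against \<open>u \<noteq> u'\<close>.\<close>
    have "P2 \<noteq> [] \<or> Q2 \<noteq> []"
      using \<open>u \<noteq> u'\<close> P(3) Q(3) P12 Q12 by auto
    then have "length C \<ge> 3"
      by (auto simp: C_def Suc_le_eq)
    moreover have "is_path T C" "{last C, hd C} \<in> edges T"
    proof -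
      let ?adj = "\<lambda>a b. {a, b} \<in> edges T"
      have "is_path T (P1 @ (z # P2) @ [w])" "is_path T (Q1 @ z # Q2 @ [w])"
        using P(1) Q(1) P12(1) Q12 by (simp_all add: path_between_def)
      then have *: "distinct (z # P2 @ [w])" "distinct (z # Q2 @ [w])"
        "set (z # P2 @ [w]) \<subseteq> verts T" "set (z # Q2 @ [w]) \<subseteq> verts T"
        "successively ?adj ((z # P2) @ [w])" "successively ?adj (z # Q2 @ [w])"
        unfolding is_path_iff_successively successively_append_iff by auto
      have "successively ?adj (rev (z # Q2 @ [w]))"
        using *(6) unfolding successively_rev by (simp only: insert_commute)
      then have closing: "successively ?adj ((w # rev Q2) @ [z])"
        by simp
      have "successively ?adj ((z # P2) @ (w # rev Q2))"
        using *(5) closing unfolding successively_append_iff by simp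
      moreover have "set P2 \<inter> set Q2 = {}"
        using P12(3) Q12 by auto
      ultimately show "is_path T C"
        using * by (auto simp: is_path_iff_successively C_def)
      show "{last C, hd C} \<in> edges T"
        using closing unfolding successively_append_iff C_def by simp
    qed
    ultimately have "is_cycle T C"
      by (simp add: is_cycle_def)
    then show False
      using tree by (auto simp: is_tree_def)
  qed
  have "\<exists>P. path_between T ?r (P @ [w]) w \<and> P \<noteq> []" if w: "w \<in> V - {?r}" for w
  proof -
    obtain xs where xs: "path_between T ?r xs w"
      using path w by blast
    then have "xs \<noteq> []" "last xs = w"
      by (auto simp: path_between_def is_path_def)
    then have split: "xs = butlast xs @ [w]"
      by (metis append_butlast_last_id)
    moreover have "butlast xs \<noteq> []"
    proof
      assume "butlast xs = []"
      with split xs w show False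
        by (metis DiffD2 append_Nil list.sel(1) path_between_def singletonI)
    qed
    ultimately show ?thesis
      using xs by metis
  qed
  then obtain P where P: "path_between T ?r (P w @ [w]) w" "P w \<noteq> []" if "w \<in> V - {?r}" for w
    by metis
  define f where "f w = last (P w)" for w
  have f: "f w \<in> V" "f w < w" "{f w, w} \<in> edges T" if "w \<in> V - {?r}" for w
  proof -
    have "is_path T (P w @ [w])"
      using P[OF that] by (auto simp: path_between_def)
    then show "f w \<in> V" "{f w, w} \<in> edges T"
      using P(2)[OF that] V
      by (auto simp: f_def is_path_iff_successively successively_append_iff)
    show "f w < w"
      using sorted[OF P(1)[OF that]] P(2)[OF that] by (auto simp: f_def sorted_wrt_append)
  qed
  have edge: "w \<in> V - {?r} \<and> u = f w" if "{u, w} \<in> edges T" "u < w" for u w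
  proof -
    have uw: "u \<in> V" "w \<in> V"
      using simple[OF that(1)] by auto
    obtain xs where xs: "path_between T ?r xs u"
      using path uw by blast
    then have xs': "xs \<noteq> []" "last xs = u"
      by (auto simp: path_between_def is_path_def)
    have w: "w \<in> V - {?r}"
      using that(2) uw fin Min_le[of V u] by (auto simp: leD)
    \<comment> \<open>An increasing path ending in \<open>u\<close> stays at or below
      \<open>u\<close>, so it avoids \<open>w\<close> and can be prolonged by the edge to
      \<open>w\<close>.\<close>
    have "x \<le> u" if "x \<in> set xs" for x
      using that sorted[OF xs] xs' by (induction xs rule: rev_induct) (auto simp: sorted_wrt_append)
    then have "w \<notin> set xs"
      using that(2) by (auto simp: leD)
    then have "path_between T ?r (xs @ [w]) w"
      using xs xs' uw that V by (auto simp: path_between_def is_path_iff_successively successively_append_iff)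
    from uniq[OF this xs'(1,2) P[OF w]] w show ?thesis
      by (simp add: f_def)
  qed
  have "edges T = (\<lambda>w. {f w, w}) ` (V - {?r})"
  proof (intro equalityI subsetI)
    fix e assume e: "e \<in> edges T"
    then obtain u w where "e = {u, w}" "u \<noteq> w"
      using simple by (meson card_2_iff)
    then obtain u w where "e = {u, w}" "u < w"
      by (metis insert_commute neqE)
    with edge e show "e \<in> (\<lambda>w. {f w, w}) ` (V - {?r})"
      by blast
  qed (use f in auto)
  then have T: "T = parent_graph V {?r} f"
    using V by (cases T) (simp add: parent_graph_def)
  have "parent_tree V ?r f"
    by unfold_locales (use fin r f in auto)
  with T show ?thesis
    using that by blast
qed

section \<open>Counting functions by their number of zeros\<close>

text \<open>Common counting step for trees, starlike trees and distributions. At the new argument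
  \<open>x\<close> a function takes either the value \<open>z\<close>, which adds a zero, or a value
  in \<open>A g\<close>; the number of such values may depend on \<open>g\<close> only through its
  number of zeros.\<close>

lemma card_extensions:
  fixes P :: "('a \<Rightarrow> 'b) set" and A :: "('a \<Rightarrow> 'b) \<Rightarrow> 'b set"
  assumes "finite I" "x \<notin> I" "finite P" "P \<subseteq> extensional I"
    and A: "\<And>g. g \<in> P \<Longrightarrow> finite (A g) \<and> z \<notin> A g \<and> card (A g) = c (card {i \<in> I. g i = z})"
  shows "card {h \<in> (\<Union>g\<in>P. (\<lambda>y. g(x := y)) ` insert z (A g)). card {i \<in> insert x I. h i = z} = m} =
    c m * card {g \<in> P. card {i \<in> I. g i = z} = m} +
    (if m = 0 then 0 else card {g \<in> P. card {i \<in> I. g i = z} = m - 1})"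
proof -
  define Z where "Z g = card {i \<in> I. g i = z}" for g
  have Z_upd: "card {i \<in> insert x I. (g(x := y)) i = z} = (if y = z then Suc (Z g) else Z g)" for g y
  proof -
    have "{i \<in> insert x I. (g(x := y)) i = z} =
        (if y = z then insert x {i \<in> I. g i = z} else {i \<in> I. g i = z})"
      using assms(2) by auto
    then show ?thesis
      using assms(1,2) by (simp add: Z_def)
  qed
  define P1 where "P1 = {g \<in> P. Suc (Z g) = m}"
  define P2 where "P2 = (SIGMA g:{g \<in> P. Z g = m}. A g)"
  let ?u1 = "\<lambda>g. g(x := z)" and ?u2 = "\<lambda>(g, y). g(x := y)"
  \<comment> \<open>Members of \<open>P\<close> have the value \<open>undefined\<close> at
    \<open>x\<close>, so an updated function determines both the original and the new value.\<close>
  have inj: "g = g' \<and> y = y'" if "g(x := y) = g'(x := y')" "g \<in> P" "g' \<in> P" for g g' y y'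
  proof -
    have "g x = undefined" "g' x = undefined"
      using that assms(2,4) by (auto simp: extensional_def)
    then have "g i = g' i" for i
      using fun_cong[OF that(1), of i] by (cases "i = x") auto
    moreover have "y = y'"
      using fun_cong[OF that(1), of x] by simp
    ultimately show ?thesis
      by auto
  qed
  have "{h \<in> (\<Union>g\<in>P. (\<lambda>y. g(x := y)) ` insert z (A g)). card {i \<in> insert x I. h i = z} = m} =
      ?u1 ` P1 \<union> ?u2 ` P2" (is "?H = _")
  proof (intro equalityI subsetI)
    fix h assume "h \<in> ?H"
    then obtain g y where "g \<in> P" "y \<in> insert z (A g)" "h = g(x := y)"
      "card {i \<in> insert x I. (g(x := y)) i = z} = m"
      by blast
    then show "h \<in> ?u1 ` P1 \<union> ?u2 ` P2"
      using A unfolding P1_def P2_def Z_upd by (auto split: if_splits)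
  next
    fix h assume "h \<in> ?u1 ` P1 \<union> ?u2 ` P2"
    then consider g where "g \<in> P" "Suc (Z g) = m" "h = g(x := z)"
      | g y where "g \<in> P" "Z g = m" "y \<in> A g" "h = g(x := y)"
      unfolding P1_def P2_def by auto
    then obtain g y where g: "g \<in> P" "y \<in> insert z (A g)" and h: "h = g(x := y)"
      and "(if y = z then Suc (Z g) else Z g) = m"
    proof cases
      case (1 g)
      then show ?thesis
        using that[of g z] by simp
    next
      case (2 g y)
      then have "y \<noteq> z"
        using A by blast
      with 2 show ?thesis
        using that[of g y] by simp
    qed
    then have "card {i \<in> insert x I. h i = z} = m"
      unfolding h Z_upd by simp
    with g h show "h \<in> ?H"
      by blast
  qed
  moreover have "?u1 ` P1 \<inter> ?u2 ` P2 = {}"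
    using A unfolding P1_def P2_def by (auto dest!: inj)
  moreover have "finite P1" "finite P2"
    using assms(3) A by (auto simp: P1_def P2_def intro!: finite_SigmaI)
  moreover have "card (?u1 ` P1) = card P1"
    by (intro card_image inj_onI) (auto simp: P1_def dest!: inj)
  moreover have "card (?u2 ` P2) = card P2"
    by (intro card_image inj_onI) (auto simp: P2_def dest!: inj)
  moreover have "card P2 = c m * card {g \<in> P. Z g = m}"
  proof -
    have "card P2 = (\<Sum>g\<in>{g \<in> P. Z g = m}. card (A g))"
      unfolding P2_def using assms(3) A by (intro card_SigmaI) auto
    also have "\<dots> = (\<Sum>g\<in>{g \<in> P. Z g = m}. c m)"
      using A by (intro sum.cong) (auto simp: Z_def)
    finally show ?thesis
      by simp
  qed
  moreover have "card P1 = (if m = 0 then 0 else card {g \<in> P. Z g = m - 1})"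
    by (cases m) (auto simp: P1_def)
  ultimately show ?thesis
    by (simp add: card_Un_disjoint Z_def)
qed

text \<open>Balls \<open>I\<close>, permitted urns \<open>U i\<close> of capacity one, and an urn
  \<open>z\<close> of unbounded capacity. Distributions are of this kind, and so are parent
  functions of starlike trees, with children as balls and parents as urns.\<close>

definition placements :: "'a set \<Rightarrow> ('a \<Rightarrow> 'b set) \<Rightarrow> 'b \<Rightarrow> ('a \<Rightarrow> 'b) set" where
  "placements I U z =
     {d \<in> Pi\<^sub>E I (\<lambda>i. insert z (U i)). \<forall>i\<in>I. \<forall>j\<in>I. d i = d j \<and> d i \<noteq> z \<longrightarrow> i = j}"

lemma placements_iff:
  "d \<in> placements I U z \<longleftrightarrow> d \<in> extensional I \<and> (\<forall>i\<in>I. d i = z \<or> d i \<in> U i) \<and>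
     (\<forall>i\<in>I. \<forall>j\<in>I. d i = d j \<and> d i \<noteq> z \<longrightarrow> i = j)"
  by (auto simp: placements_def PiE_iff)

lemma placements_cong:
  "(\<And>i. i \<in> I \<Longrightarrow> U i = U' i) \<Longrightarrow> placements I U z = placements I U' z"
  unfolding placements_def by (metis (mono_tags, lifting) PiE_cong)

lemma finite_placements:
  assumes "finite I" "\<And>i. i \<in> I \<Longrightarrow> finite (U i)"
  shows "finite (placements I U z)"
proof (rule finite_subset)
  show "placements I U z \<subseteq> Pi\<^sub>E I (\<lambda>i. insert z (U i))"
    by (auto simp: placements_def)
  show "finite (Pi\<^sub>E I (\<lambda>i. insert z (U i)))"
    using assms by (intro finite_PiE) auto
qed

lemma placements_insert:
  assumes "x \<notin> I"
  shows "placements (insert x I) U z =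
    (\<Union>g\<in>placements I U z. (\<lambda>y. g(x := y)) ` insert z (U x - g ` I))"
proof (intro equalityI subsetI)
  fix h assume h: "h \<in> placements (insert x I) U z"
  then have hI: "\<And>i. i \<in> insert x I \<Longrightarrow> h i \<in> insert z (U i)"
    and h_ext: "h \<in> extensional (insert x I)"
    and inj: "\<And>i j. i \<in> insert x I \<Longrightarrow> j \<in> insert x I \<Longrightarrow> h i = h j \<Longrightarrow> h i \<noteq> z \<Longrightarrow> i = j"
    by (auto simp: placements_def PiE_iff)
  let ?g = "restrict h I"
  have "?g \<in> placements I U z"
    unfolding placements_def using hI inj by auto
  moreover have "h = ?g(x := h x)"
    using h_ext assms by (intro ext) (auto simp: extensional_def restrict_def)
  moreover have "h x \<in> insert z (U x - ?g ` I)"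
  proof -
    have "h x \<notin> h ` I" if "h x \<noteq> z"
      using inj[of x] that assms by blast
    then show ?thesis
      using hI[of x] by auto
  qed
  ultimately show "h \<in> (\<Union>g\<in>placements I U z. (\<lambda>y. g(x := y)) ` insert z (U x - g ` I))"
    by blast
next
  fix h assume "h \<in> (\<Union>g\<in>placements I U z. (\<lambda>y. g(x := y)) ` insert z (U x - g ` I))"
  then obtain g y where g: "g \<in> placements I U z" and y: "y = z \<or> y \<in> U x \<and> y \<notin> g ` I"
    and h: "h = g(x := y)"
    by auto
  have gI: "g \<in> extensional I" "\<And>i. i \<in> I \<Longrightarrow> g i = z \<or> g i \<in> U i"
    and inj: "\<And>i j. i \<in> I \<Longrightarrow> j \<in> I \<Longrightarrow> g i = g j \<Longrightarrow> g i \<noteq> z \<Longrightarrow> i = j"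
    using g unfolding placements_iff by blast+
  have "i = j" if "i \<in> insert x I" "j \<in> insert x I" "h i = h j" "h i \<noteq> z" for i j
  proof (cases "i = x \<or> j = x")
    case True
    then show ?thesis
      using that y unfolding h by (auto split: if_splits)
  next
    case False
    then show ?thesis
      using that inj unfolding h by auto
  qed
  moreover have "h \<in> extensional (insert x I)"
    using gI(1) by (auto simp: h extensional_def)
  moreover have "h i = z \<or> h i \<in> U i" if "i \<in> insert x I" for i
    using that y gI(2) by (auto simp: h)
  ultimately show "h \<in> placements (insert x I) U z"
    unfolding placements_iff by blast
qed

text \<open>\<open>x\<close> comes last: the urns other than \<open>z\<close> used by the balls in
  \<open>I\<close> are distinct and all lie in \<open>U x\<close>. With \<open>m\<close> balls in
  \<open>z\<close>, exactly \<open>card I - m\<close> urns are blocked for \<open>x\<close>.\<close>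

lemma card_placements_insert:
  assumes "finite I" "x \<notin> I" "\<And>i. i \<in> I \<Longrightarrow> U i \<subseteq> U x" "finite (U x)" "z \<notin> U x"
  shows "card {g \<in> placements (insert x I) U z. card {i \<in> insert x I. g i = z} = m} =
    (card (U x) - (card I - m)) * card {g \<in> placements I U z. card {i \<in> I. g i = z} = m} +
    (if m = 0 then 0 else card {g \<in> placements I U z. card {i \<in> I. g i = z} = m - 1})"
  unfolding placements_insert[OF assms(2)]
proof (rule card_extensions)
  show "finite (placements I U z)"
    using assms by (intro finite_placements) (auto intro: finite_subset)
  show "placements I U z \<subseteq> extensional I"
    by (auto simp: placements_def PiE_iff)
  fix g assume g: "g \<in> placements I U z"
  have "U x - g ` I = U x - g ` {i \<in> I. g i \<noteq> z}"
    using assms(5) by auto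
  moreover have "g ` {i \<in> I. g i \<noteq> z} \<subseteq> U x"
  proof
    fix y assume "y \<in> g ` {i \<in> I. g i \<noteq> z}"
    then obtain i where "i \<in> I" "y = g i" "g i \<noteq> z"
      by auto
    with g have "y \<in> U i"
      by (auto simp: placements_def PiE_iff)
    with assms(3) \<open>i \<in> I\<close> show "y \<in> U x"
      by blast
  qed
  moreover have "card (g ` {i \<in> I. g i \<noteq> z}) = card I - card {i \<in> I. g i = z}"
  proof -
    have "inj_on g {i \<in> I. g i \<noteq> z}"
      using g by (auto simp: placements_def inj_on_def)
    then have "card (g ` {i \<in> I. g i \<noteq> z}) = card {i \<in> I. g i \<noteq> z}"
      by (rule card_image)
    also have "\<dots> = card (I - {i \<in> I. g i = z})"
      by (rule arg_cong[of _ _ card]) auto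
    finally show ?thesis
      using assms(1) by (simp add: card_Diff_subset)
  qed
  ultimately show "finite (U x - g ` I) \<and> z \<notin> U x - g ` I \<and>
      card (U x - g ` I) = card (U x) - (card I - card {i \<in> I. g i = z})"
    using assms(1,4,5) by (simp add: card_Diff_subset)
qed (use assms in auto)

lemma card_PiE_insert_zeros:
  assumes "finite I" "x \<notin> I" "\<And>i. i \<in> I \<Longrightarrow> finite (U i)" "finite (U x)" "z \<notin> U x"
  shows "card {g \<in> Pi\<^sub>E (insert x I) (\<lambda>i. insert z (U i)). card {i \<in> insert x I. g i = z} = m} =
    card (U x) * card {g \<in> Pi\<^sub>E I (\<lambda>i. insert z (U i)). card {i \<in> I. g i = z} = m} +
    (if m = 0 then 0 else card {g \<in> Pi\<^sub>E I (\<lambda>i. insert z (U i)). card {i \<in> I. g i = z} = m - 1})"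
proof -
  have eq: "Pi\<^sub>E (insert x I) (\<lambda>i. insert z (U i)) =
      (\<Union>g\<in>Pi\<^sub>E I (\<lambda>i. insert z (U i)). (\<lambda>y. g(x := y)) ` insert z (U x))"
    unfolding PiE_insert_eq by auto
  show ?thesis
    unfolding eq
    by (rule card_extensions) (use assms in \<open>auto simp: PiE_iff intro!: finite_PiE\<close>)
qed

text \<open>This is the recurrence of the Stirling numbers of the first kind: the largest vertex
  \<open>Suc p\<close> hangs below \<open>0\<close> or below one of the \<open>p\<close> other
  vertices.\<close>

lemma card_parent_functions:
  "card {g \<in> Pi\<^sub>E {1..p} (\<lambda>i. insert 0 {1..<i}). card {i \<in> {1..p}. g i = 0} = j} = stirling p j"
proof (induction p arbitrary: j)
  case 0
  have "{g \<in> Pi\<^sub>E {1..0::nat} (\<lambda>i. insert 0 {1..<i}). card {i \<in> {1..0::nat}. g i = 0} = j} =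
      (if j = 0 then {\<lambda>_. undefined} else {})"
    by auto
  then show ?case
    by (cases j) simp_all
next
  case (Suc p)
  have ins: "{1..Suc p} = insert (Suc p) {1..p}"
    by auto
  have "card {g \<in> Pi\<^sub>E {1..Suc p} (\<lambda>i. insert 0 {1..<i}). card {i \<in> {1..Suc p}. g i = 0} = j} =
      p * stirling p j + (if j = 0 then 0 else stirling p (j - 1))"
    unfolding ins
    by (subst card_PiE_insert_zeros, unfold Suc.IH) auto
  then show ?case
    by (cases j; cases p) auto
qed

text \<open>The largest element goes below the root, starting a new path, or to the end of one of
  the \<open>m\<close> existing paths, because the other \<open>card I - m\<close> vertices already
  have a child. This is the recurrence of set partitions into \<open>m\<close> blocks.\<close>

lemma card_starlike_parent_functions:
  fixes I :: "'a::linorder set"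
  assumes "finite I" "\<And>i. i \<in> I \<Longrightarrow> z < i"
  shows "card {g \<in> placements I (\<lambda>i. {u \<in> I. u < i}) z. card {i \<in> I. g i = z} = m} =
    Stirling (card I) m"
  using assms
proof (induction I arbitrary: m rule: finite_linorder_max_induct)
  case empty
  have "{g \<in> placements {} (\<lambda>i. {u \<in> {}. u < i}) z. card {i \<in> {}. g i = z} = m} =
      (if m = 0 then {\<lambda>_. undefined} else {})"
    by (auto simp: placements_def)
  then show ?case
    by (cases m) simp_all
next
  case (insert x I)
  let ?U = "\<lambda>i. {u \<in> insert x I. u < i}"
  have Ux: "?U x = I"
    using insert.hyps by auto
  have "placements I ?U z = placements I (\<lambda>i. {u \<in> I. u < i}) z"
    by (rule placements_cong) (use insert.hyps in fastforce)
  then have IH: "card {g \<in> placements I ?U z. card {i \<in> I. g i = z} = m} = Stirling (card I) m" for m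
    using insert by simp
  have x: "x \<notin> I"
    using insert.hyps by auto
  have "card {g \<in> placements (insert x I) ?U z. card {i \<in> insert x I. g i = z} = m} =
      (card I - (card I - m)) * Stirling (card I) m + (if m = 0 then 0 else Stirling (card I) (m - 1))"
    by (subst card_placements_insert, unfold IH Ux) (use insert x in \<open>auto simp: less_le_not_le\<close>)
  \<comment> \<open>For \<open>m > card I\<close> the subtraction is truncated, but then
    \<open>Stirling (card I) m\<close> vanishes.\<close>
  also have "(card I - (card I - m)) * Stirling (card I) m = m * Stirling (card I) m"
    by (cases "m \<le> card I") auto
  also have "m * Stirling (card I) m + (if m = 0 then 0 else Stirling (card I) (m - 1)) =
      Stirling (card (insert x I)) m"
    using insert.hyps x by (cases m) auto
  finally show ?case .
qed

section \<open>The common recurrence and its solution\<close>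

fun normal_coeff :: "nat \<Rightarrow> nat \<Rightarrow> nat \<Rightarrow> nat" where
  "normal_coeff k 0 m = (if m = 0 then 1 else 0)"
| "normal_coeff k (Suc p) m =
     (p * (k - 1) + m) * normal_coeff k p m + (if m = 0 then 0 else normal_coeff k p (m - 1))"

lemma normal_coeff_eq_0: "p < m \<Longrightarrow> normal_coeff k p m = 0"
  by (induction p arbitrary: m) auto

text \<open>Together with \<open>normal_coeff_eq_0\<close> it supplies the side conditions of
  \<open>is_normal_ordering_Suc\<close>.\<close>

lemma normal_coeff_0: "p \<ge> 1 \<Longrightarrow> normal_coeff k p 0 = 0"
  by (induction p rule: dec_induct) auto

text \<open>The ceiling condition turns into an initial segment of urns. These segments grow with
  \<open>i\<close>, which makes the last ball the right one to insert.\<close>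

lemma distributions_eq_placements:
  assumes "k \<ge> 1"
  shows "distributions p k = placements {1..p} (\<lambda>i. {1..(i - 1) * k}) 0"
proof -
  have ceil: "\<lceil>real n / real k\<rceil> < int i \<longleftrightarrow> n \<le> (i - 1) * k" if "i \<ge> 1" for n i
  proof -
    have "\<lceil>real n / real k\<rceil> < int i \<longleftrightarrow> \<lceil>real n / real k\<rceil> \<le> int (i - 1)"
      using that by linarith
    also have "\<dots> \<longleftrightarrow> real n / real k \<le> real (i - 1)"
      by (simp add: ceiling_le_iff)
    also have "\<dots> \<longleftrightarrow> real n \<le> real ((i - 1) * k)"
      using assms by (simp add: field_simps)
    finally show ?thesis
      by linarith
  qed
  have mono: "(i - 1) * k \<le> p * k" if "i \<in> {1..p}" for i
    using that by (intro mult_right_mono) auto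
  have card: "(\<forall>j\<in>{1..p * k}. card {i \<in> {1..p}. d i = j} \<le> 1) \<longleftrightarrow>
      (\<forall>i\<in>{1..p}. \<forall>i'\<in>{1..p}. d i = d i' \<and> d i \<noteq> 0 \<longrightarrow> i = i')"
    if d: "\<forall>i\<in>{1..p}. d i \<le> p * k" for d
  proof -
    have "card {i \<in> {1..p}. d i = j} \<le> 1 \<longleftrightarrow>
        (\<forall>i\<in>{1..p}. \<forall>i'\<in>{1..p}. d i = j \<and> d i' = j \<longrightarrow> i = i')" for j
      unfolding One_nat_def
      using card_le_Suc0_iff_eq[of "{i \<in> {1..p}. d i = j}"] by (simp add: Ball_def) blast
    then have "(\<forall>j\<in>{1..p * k}. card {i \<in> {1..p}. d i = j} \<le> 1) \<longleftrightarrow>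
        (\<forall>j\<in>{1..p * k}. \<forall>i\<in>{1..p}. \<forall>i'\<in>{1..p}. d i = j \<and> d i' = j \<longrightarrow> i = i')"
      by blast
    also have "\<dots> \<longleftrightarrow> (\<forall>i\<in>{1..p}. \<forall>i'\<in>{1..p}. d i = d i' \<and> d i \<in> {1..p * k} \<longrightarrow> i = i')"
      by metis
    also have "\<dots> \<longleftrightarrow> (\<forall>i\<in>{1..p}. \<forall>i'\<in>{1..p}. d i = d i' \<and> d i \<noteq> 0 \<longrightarrow> i = i')"
    proof -
      have "d i \<in> {1..p * k} \<longleftrightarrow> d i \<noteq> 0" if "i \<in> {1..p}" for i
        using d that by auto
      then show ?thesis
        by blast
    qed
    finally show ?thesis .
  qed
  show ?thesis
  proof (intro equalityI subsetI)
    fix d assume d: "d \<in> distributions p k"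
    then have *: "d \<in> extensional {1..p}" "\<forall>i\<in>{1..p}. d i \<le> p * k" "\<forall>i\<in>{1..p}. d i \<le> (i - 1) * k"
      using ceil by (auto simp: distributions_def PiE_iff)
    have "\<forall>i\<in>{1..p}. \<forall>i'\<in>{1..p}. d i = d i' \<and> d i \<noteq> 0 \<longrightarrow> i = i'"
      using card[OF *(2)] d unfolding distributions_def by blast
    moreover have "\<forall>i\<in>{1..p}. d i = 0 \<or> d i \<in> {1..(i - 1) * k}"
      using *(3) by (auto simp: Suc_le_eq)
    ultimately show "d \<in> placements {1..p} (\<lambda>i. {1..(i - 1) * k}) 0"
      unfolding placements_iff using *(1) by blast
  next
    fix d assume "d \<in> placements {1..p} (\<lambda>i. {1..(i - 1) * k}) 0"
    then have d: "d \<in> extensional {1..p}"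
      "\<forall>i\<in>{1..p}. \<forall>i'\<in>{1..p}. d i = d i' \<and> d i \<noteq> 0 \<longrightarrow> i = i'"
      and "\<forall>i\<in>{1..p}. d i = 0 \<or> d i \<in> {1..(i - 1) * k}"
      unfolding placements_iff by - (elim conjE, assumption)+
    then have d_le: "\<forall>i\<in>{1..p}. d i \<le> (i - 1) * k"
      by (metis atLeastAtMost_iff zero_le)
    have le: "\<forall>i\<in>{1..p}. d i \<le> p * k"
      using d_le mono by (meson le_trans)
    have "\<forall>j\<in>{1..p * k}. card {i \<in> {1..p}. d i = j} \<le> 1"
      using card[OF le] d(2) by blast
    moreover have "\<forall>i\<in>{1..p}. \<lceil>real (d i) / real k\<rceil> < int i"
      using ceil d_le by simp
    ultimately show "d \<in> distributions p k"
      using d(1) le by (simp add: distributions_def PiE_iff)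
  qed
qed

lemma card_distributions:
  assumes "k \<ge> 1"
  shows "card {d \<in> distributions p k. card {i \<in> {1..p}. d i = 0} = m} = normal_coeff k p m"
  unfolding distributions_eq_placements[OF assms]
proof (induction p arbitrary: m)
  case 0
  have "{d \<in> placements {1..0::nat} (\<lambda>i. {1..(i - 1) * k}) 0. card {i \<in> {1..0::nat}. d i = 0} = m} =
      (if m = 0 then {\<lambda>_. undefined} else {})"
    by (auto simp: placements_def)
  then show ?case
    by simp
next
  case (Suc p)
  let ?U = "\<lambda>i. {1..(i - 1) * k}"
  have ins: "{1..Suc p} = insert (Suc p) {1..p}"
    by auto
  have sub: "?U i \<subseteq> ?U (Suc p)" if "i \<in> {1..p}" for i
    using that mult_right_mono[of "i - 1" p k] by auto
  have "card {d \<in> placements {1..Suc p} ?U 0. card {i \<in> {1..Suc p}. d i = 0} = m} =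
      (p * k - (p - m)) * normal_coeff k p m + (if m = 0 then 0 else normal_coeff k p (m - 1))"
    unfolding ins
    by (subst card_placements_insert, unfold Suc.IH) (use sub in auto)
  \<comment> \<open>For \<open>m \<le> p\<close> this is plain arithmetic; beyond that the truncated
    difference is harmless, since the coefficient is \<open>0\<close>.\<close>
  also have "(p * k - (p - m)) * normal_coeff k p m = (p * (k - 1) + m) * normal_coeff k p m"
  proof (cases "m \<le> p")
    case True
    have "p * k = p * (k - 1) + p"
      using assms by (cases k) auto
    then show ?thesis
      using True by simp
  qed (simp add: normal_coeff_eq_0)
  finally show ?case
    by simp
qed

text \<open>Expand \<open>stirling (Suc p) (Suc j)\<close> into
  \<open>p * stirling p (Suc j) + stirling p j\<close>, and in the second summand also
  \<open>Stirling (Suc j) m\<close>. The first part reproduces terms of the old sum with an extra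
  factor \<open>p * (k - 1)\<close>, the second yields the factor \<open>m\<close> and the shift to
  \<open>m - 1\<close>.\<close>

lemma normal_coeff_eq_sum:
  "normal_coeff k p m = (\<Sum>j=m..p. stirling p j * Stirling j m * (k - 1) ^ (p - j))"
proof -
  let ?q = "k - 1"
  define a where "a p m j = stirling p j * Stirling j m * ?q ^ (p - j)" for p m j
  have Stirling_Suc: "Stirling (Suc j) m = m * Stirling j m + (if m = 0 then 0 else Stirling j (m - 1))"
    for j m
    by (cases m) auto
  \<comment> \<open>Summing from \<open>0\<close> keeps the range independent of \<open>m\<close>;
    the terms with \<open>j < m\<close> vanish.\<close>
  have "normal_coeff k p m = (\<Sum>j\<le>p. a p m j)"
  proof (induction p arbitrary: m)
    case 0
    show ?case
      by (cases m) (auto simp: a_def)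
  next
    case (Suc p)
    have first: "stirling p (Suc j) * Stirling (Suc j) m * ?q ^ (p - j) = ?q * a p m (Suc j)"
      if "j \<le> p" for j
    \<comment> \<open>For \<open>j = p\<close> the exponent \<open>p - Suc j\<close> is truncated,
      but \<open>stirling p (Suc p) = 0\<close> makes both sides vanish.\<close>
    proof (cases "j = p")
      case False
      with that have "p - j = Suc (p - Suc j)"
        by simp
      then show ?thesis
        by (simp add: a_def)
    qed (simp add: a_def)
    \<comment> \<open>The shifted sum loses the term at \<open>0\<close> and gains the one at
      \<open>Suc p\<close>. The latter is \<open>0\<close>, and the factor \<open>p\<close> removes
      the former even for \<open>p = 0\<close>, where \<open>stirling 0 0 = 1\<close>.\<close>
    have shift: "p * (\<Sum>j\<le>p. a p m (Suc j)) = p * (\<Sum>j\<le>p. a p m j)"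
    proof -
      have "(\<Sum>j\<le>Suc p. a p m j) = a p m 0 + (\<Sum>j\<le>p. a p m (Suc j))"
        by (rule sum.atMost_Suc_shift)
      moreover have "a p m (Suc p) = 0" "p * a p m 0 = 0"
        by (auto simp: a_def)
      ultimately show ?thesis
        by (simp add: distrib_left)
    qed
    have "(\<Sum>j\<le>Suc p. a (Suc p) m j) = (\<Sum>j\<le>p. a (Suc p) m (Suc j))"
      unfolding sum.atMost_Suc_shift by (simp add: a_def)
    also have "\<dots> = (\<Sum>j\<le>p. p * (?q * a p m (Suc j)) + (m * a p m j + (if m = 0 then 0 else a p (m - 1) j)))"
    proof (rule sum.cong)
      fix j assume "j \<in> {..p}"
      then have "a (Suc p) m (Suc j) = p * (?q * a p m (Suc j)) + stirling p j * Stirling (Suc j) m * ?q ^ (p - j)"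
        using first[of j] by (simp add: a_def algebra_simps del: Stirling.simps)
      then show "a (Suc p) m (Suc j) =
          p * (?q * a p m (Suc j)) + (m * a p m j + (if m = 0 then 0 else a p (m - 1) j))"
        unfolding Stirling_Suc by (simp add: a_def algebra_simps)
    qed simp
    also have "\<dots> = ?q * (p * (\<Sum>j\<le>p. a p m (Suc j))) + m * (\<Sum>j\<le>p. a p m j) +
        (if m = 0 then 0 else (\<Sum>j\<le>p. a p (m - 1) j))"
      by (simp add: sum.distrib sum_distrib_left mult_ac)
    also have "\<dots> = normal_coeff k (Suc p) m"
      unfolding shift by (simp add: Suc.IH[symmetric] algebra_simps)
    finally show ?case ..
  qed
  also have "\<dots> = (\<Sum>j=m..p. a p m j)"
    by (rule sum.mono_neutral_right) (auto simp: a_def)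
  finally show ?thesis
    by (simp add: a_def)
qed

lemma alpha_eq_normal_coeff:
  assumes "p \<ge> 1" "k \<ge> 1" "m \<in> {1..p}"
  shows "alpha p k m = real (normal_coeff k p m)"
proof -
  have "is_normal_ordering p k (\<lambda>m. real (normal_coeff k p m))"
    using assms(1)
  proof (induction p rule: dec_induct)
    case base
    show ?case
      using assms(2)
      by (simp add: is_normal_ordering_def xkD_def mult_monom mult.assoc[symmetric])
  next
    case (step p)
    have "is_normal_ordering (Suc p) k (\<lambda>m. of_nat (p * (k - 1) + m) * real (normal_coeff k p m) +
        (if m = 0 then 0 else real (normal_coeff k p (m - 1))))"
      by (rule is_normal_ordering_Suc) (use assms step in \<open>auto simp: normal_coeff_0 normal_coeff_eq_0\<close>)
    moreover have "(\<lambda>m. of_nat (p * (k - 1) + m) * real (normal_coeff k p m) +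
        (if m = 0 then 0 else real (normal_coeff k p (m - 1)))) = (\<lambda>m. real (normal_coeff k (Suc p) m))"
      by (intro ext) simp
    ultimately show ?case
      by simp
  qed
  then show ?thesis
    using normal_ordering_unique[OF is_normal_ordering_alpha[OF assms(1,2)] _ assms(3)] by simp
qed

section \<open>Forests of distributions\<close>

text \<open>For \<open>1 \<le> r < k\<close> these are the children of \<open>rt i\<close>, numbered
  by the colour \<open>r\<close> that \<open>Omega\<close> will use. They fill the gap between
  \<open>ball_vertex k i\<close>, the case \<open>r = 0\<close>, and
  \<open>ball_vertex k (i + 1)\<close>.\<close>

definition branch_vertex :: "nat \<Rightarrow> nat \<Rightarrow> nat \<Rightarrow> int" where
  "branch_vertex k i r = (int i - 1) * int k + int r + 1"

definition forest_verts :: "nat \<Rightarrow> nat \<Rightarrow> int set" where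
  "forest_verts p k = {0..(int p - 1) * int k + 1} \<union> rt ` {1..p - 1}"

definition forest_roots :: "nat \<Rightarrow> int set" where
  "forest_roots p = rt ` {0..p - 1}"

text \<open>Division of \<open>v - 1\<close> by \<open>k\<close> tells the two kinds of positive
  vertices apart: with remainder \<open>0\<close>, \<open>v\<close> is the vertex of ball
  \<open>q\<close>; otherwise it is a child of the root encoded by \<open>- q\<close>.\<close>

definition forest_parent :: "nat \<Rightarrow> (nat \<Rightarrow> nat) \<Rightarrow> int \<Rightarrow> int" where
  "forest_parent k d v = (let q = (v - 1) div int k + 1 in
     if (v - 1) mod int k = 0 then int (d (nat q)) else - q)"

definition dist_forest :: "nat \<Rightarrow> nat \<Rightarrow> (nat \<Rightarrow> nat) \<Rightarrow> int graph" where
  "dist_forest p k d = parent_graph (forest_verts p k) (forest_roots p) (forest_parent k d)"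

lemma rt_eq_iff [simp]: "rt i = rt j \<longleftrightarrow> i = j"
  by (simp add: rt_def)

lemma rt_0 [simp]: "rt 0 = 0"
  by (simp add: rt_def)

lemma ball_vertex_eq_iff: "k \<ge> 1 \<Longrightarrow> ball_vertex k v = ball_vertex k w \<longleftrightarrow> v = w"
  by (simp add: ball_vertex_def)

lemma ball_vertex_pos: "v \<ge> 1 \<Longrightarrow> ball_vertex k v \<ge> 1"
  by (simp add: ball_vertex_def)

lemma ball_vertex_le_iff:
  "k \<ge> 1 \<Longrightarrow> ball_vertex k v \<le> (int p - 1) * int k + 1 \<longleftrightarrow> v \<le> p"
  by (auto simp: ball_vertex_def)

lemma forest_parent_ball: "k \<ge> 1 \<Longrightarrow> v \<ge> 1 \<Longrightarrow> forest_parent k d (ball_vertex k v) = int (d v)"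
  by (simp add: forest_parent_def ball_vertex_def Let_def)

lemma forest_parent_branch:
  assumes "r \<in> {1..k - 1}"
  shows "forest_parent k d (branch_vertex k i r) = rt i"
proof -
  have "((int i - 1) * int k + int r) div int k = int i - 1"
    "((int i - 1) * int k + int r) mod int k = int r"
    using assms by auto
  then show ?thesis
    using assms by (simp add: forest_parent_def branch_vertex_def rt_def Let_def)
qed

lemma forest_nonroots:
  assumes "p \<ge> 1"
  shows "forest_verts p k - forest_roots p = {1..(int p - 1) * int k + 1}"
proof -
  have "0 \<le> (int p - 1) * int k"
    using assms by simp
  moreover have "{0..p - 1} = insert 0 {1..p - 1}"
    by auto
  ultimately show ?thesis
    by (auto simp: forest_verts_def forest_roots_def rt_def)
qed

lemma ball_vertex_nonroot:
  assumes "p \<ge> 1" "k \<ge> 1" "v \<in> {1..p}"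
  shows "ball_vertex k v \<in> forest_verts p k - forest_roots p"
  using assms ball_vertex_pos[of v k] ball_vertex_le_iff[of k v p]
  by (simp add: forest_nonroots)

lemma branch_vertex_bounds:
  assumes "i \<in> {1..p - 1}" "r \<in> {1..k - 1}"
  shows "1 \<le> branch_vertex k i r" "branch_vertex k i r \<le> (int p - 1) * int k + 1"
proof -
  have "0 \<le> (int i - 1) * int k"
    using assms by simp
  then show "1 \<le> branch_vertex k i r"
    by (simp add: branch_vertex_def)
  have "int i * int k \<le> (int p - 1) * int k"
    using assms by (intro mult_right_mono) auto
  moreover have "int r \<le> int k"
    using assms by auto
  ultimately show "branch_vertex k i r \<le> (int p - 1) * int k + 1"
    by (simp add: branch_vertex_def algebra_simps)
qed

lemma branch_vertex_nonroot:
  assumes "p \<ge> 1" "i \<in> {1..p - 1}" "r \<in> {1..k - 1}"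
  shows "branch_vertex k i r \<in> forest_verts p k - forest_roots p"
  using branch_vertex_bounds[OF assms(2,3)] assms(1) by (simp add: forest_nonroots)

lemma nonroot_cases:
  assumes "p \<ge> 1" "k \<ge> 1" "v \<in> forest_verts p k - forest_roots p"
  obtains (ball) m where "m \<in> {1..p}" "v = ball_vertex k m"
  | (branch) i r where "i \<in> {1..p - 1}" "r \<in> {1..k - 1}" "v = branch_vertex k i r"
proof -
  have v: "1 \<le> v" "v \<le> (int p - 1) * int k + 1"
    using assms by (auto simp: forest_nonroots)
  define q r where "q = (v - 1) div int k" and "r = (v - 1) mod int k"
  have vqr: "v = q * int k + r + 1"
    by (simp add: q_def r_def)
  have r: "0 \<le> r" "r < int k"
    using assms(2) by (auto simp: r_def)
  have q0: "0 \<le> q"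
    using v assms(2) by (simp add: q_def pos_imp_zdiv_nonneg_iff)
  have "q \<le> ((int p - 1) * int k) div int k"
    unfolding q_def by (intro zdiv_mono1) (use v assms(2) in auto)
  then have q: "q \<le> int p - 1"
    using assms(2) by simp
  show ?thesis
  proof (cases "r = 0")
    case True
    show ?thesis
      by (rule ball[of "nat (q + 1)"]) (use True vqr q q0 in \<open>auto simp: ball_vertex_def\<close>)
  next
    case False
    \<comment> \<open>The quotient \<open>p - 1\<close> is attained only by the top vertex
      \<open>(p - 1) * k + 1\<close>, which is a ball. So a branch vertex belongs to some
      \<open>i \<le> p - 1\<close>.\<close>
    have "q < int p - 1"
    proof (rule ccontr)
      assume "\<not> q < int p - 1"
      then have "q = int p - 1"
        using q by simp
      then show False
        using vqr v False r by simp
    qed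
    then show ?thesis
      by (intro branch[of "nat (q + 1)" "nat r"])
        (use False vqr q0 r in \<open>auto simp: branch_vertex_def nat_less_iff\<close>)
  qed
qed

lemma branch_vertices_eq:
  "{(int i - 1) * int k + 2..int i * int k} = branch_vertex k i ` {1..k - 1}"
proof (intro equalityI subsetI)
  fix v assume v: "v \<in> {(int i - 1) * int k + 2..int i * int k}"
  define r where "r = v - 1 - (int i - 1) * int k"
  have "1 \<le> r" "r \<le> int k - 1"
    using v by (auto simp: r_def algebra_simps)
  then have "nat r \<in> {1..k - 1}" "v = branch_vertex k i (nat r)"
    by (auto simp: branch_vertex_def r_def)
  then show "v \<in> branch_vertex k i ` {1..k - 1}"
    by blast
qed (auto simp: branch_vertex_def algebra_simps)

section \<open>The forest built from a fixed distribution\<close>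

locale distribution =
  fixes p k :: nat and d :: "nat \<Rightarrow> nat"
  assumes p_pos: "p \<ge> 1" and k_pos: "k \<ge> 1" and dist: "d \<in> distributions p k"
begin

abbreviation "V \<equiv> forest_verts p k"
abbreviation "R \<equiv> forest_roots p"
abbreviation "par \<equiv> forest_parent k d"
abbreviation "F \<equiv> dist_forest p k d"

lemma d_le: "m \<in> {1..p} \<Longrightarrow> d m \<le> (m - 1) * k"
  using dist unfolding distributions_eq_placements[OF k_pos] placements_iff
  by (metis atLeastAtMost_iff zero_le)

lemma d_inj: "m \<in> {1..p} \<Longrightarrow> n \<in> {1..p} \<Longrightarrow> d m = d n \<Longrightarrow> d m \<noteq> 0 \<Longrightarrow> m = n"
  using dist unfolding distributions_eq_placements[OF k_pos] placements_iff by blast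

lemmas nonroots = nonroot_cases[OF p_pos k_pos, consumes 1, case_names ball branch]
lemmas ball_nonroot = ball_vertex_nonroot[OF p_pos k_pos]
lemmas branch_nonroot = branch_vertex_nonroot[OF p_pos]

lemma par_ball: "m \<in> {1..p} \<Longrightarrow> par (ball_vertex k m) = int (d m)"
  using k_pos by (simp add: forest_parent_ball)

lemma d_less_ball:
  assumes "m \<in> {1..p}"
  shows "int (d m) < ball_vertex k m"
proof -
  have "int (d m) \<le> int ((m - 1) * k)"
    using d_le[OF assms] by linarith
  then show ?thesis
    using assms by (simp add: ball_vertex_def of_nat_diff)
qed

sublocale parent_forest V R par
proof
  show "finite V"
    by (simp add: forest_verts_def)
  have "0 \<le> (int p - 1) * int k"
    using p_pos by simp
  moreover have "{0..p - 1} = insert 0 {1..p - 1}"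
    by auto
  ultimately show "R \<subseteq> V"
    by (auto simp: forest_verts_def forest_roots_def)
  fix v assume v: "v \<in> V - R"
  show "par v \<in> V"
    using v
  proof (cases rule: nonroots)
    case (ball m)
    then have "int (d m) < ball_vertex k m" "ball_vertex k m \<le> (int p - 1) * int k + 1"
      using d_less_ball k_pos by (auto simp: ball_vertex_le_iff)
    then show ?thesis
      using ball by (simp add: par_ball forest_verts_def)
  next
    case (branch i r)
    then show ?thesis
      by (simp add: forest_parent_branch forest_verts_def)
  qed
  show "par v < v"
    using v
  proof (cases rule: nonroots)
    case (ball m)
    then show ?thesis
      by (simp add: par_ball d_less_ball)
  next
    case (branch i r)
    then show ?thesis
      using branch_vertex_bounds(1)[OF branch(1,2)] by (simp add: forest_parent_branch rt_def)
  qed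
qed

lemma F_eq: "F = G"
  by (simp add: dist_forest_def)

lemma verts_F: "verts F = V"
  and edges_F: "edges F = (\<lambda>v. {par v, v}) ` (V - R)"
  by (simp_all add: F_eq edges_parent_graph)

lemma rt_in_R: "i \<in> {0..p - 1} \<Longrightarrow> rt i \<in> R"
  by (simp add: forest_roots_def)

lemma subtree_eq: "i \<in> {0..p - 1} \<Longrightarrow> subtree F i = parent_graph (comp (rt i)) {rt i} par"
  unfolding subtree_def F_eq by (rule component_root) (rule rt_in_R)

lemma tree: "i \<in> {0..p - 1} \<Longrightarrow> parent_tree (comp (rt i)) (rt i) par"
  unfolding parent_tree_def by (rule comp_parent_forest) (rule rt_in_R)

lemma children_subtree:
  "i \<in> {0..p - 1} \<Longrightarrow> children (subtree F i) (rt i) u = {w \<in> comp (rt i) - {rt i}. par w = u}"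
  unfolding subtree_eq by (rule parent_tree.children_eq) (rule tree)

lemma comp_subset:
  assumes "i \<in> {0..p - 1}"
  shows "comp (rt i) \<subseteq> V"
proof -
  have "rt i \<in> V"
    using rt_in_R[OF assms] roots by blast
  then show ?thesis
    using reach_in by blast
qed

lemma comp_nonroot:
  assumes "i \<in> {0..p - 1}" "w \<in> comp (rt i) - {rt i}"
  shows "w \<in> V - R" "par w \<in> comp (rt i)"
proof -
  have "w \<in> V"
    using assms comp_subset by blast
  moreover have "w \<notin> R"
    using assms reach_root by auto
  ultimately show "w \<in> V - R"
    by simp
  show "par w \<in> comp (rt i)"
    using parent_forest.parent_in[OF tree[unfolded parent_tree_def], OF assms] .
qed

lemma comp_parent_root:
  assumes "i \<in> {0..p - 1}" "w \<in> comp (rt i) - {rt i}" "par w \<in> R"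
  shows "par w = rt i"
proof -
  have "rt i = par w"
    by (rule reach_root) (use comp_nonroot(2)[OF assms(1,2)] assms(3) in auto)
  then show ?thesis ..
qed

lemma nonroot_in_comp:
  assumes "i \<in> {0..p - 1}" "w \<in> V - R" "par w = rt i"
  shows "w \<in> comp (rt i) - {rt i}"
proof -
  have "step (rt i) w"
    using assms by (simp add: step_def)
  then show ?thesis
    using assms rt_in_R by auto
qed

lemma ex_comp:
  assumes "w \<in> V"
  obtains i where "i \<in> {0..p - 1}" "w \<in> comp (rt i)"
  using ex_root[OF assms] by (auto simp: forest_roots_def)

lemma comp_unique: "w \<in> comp (rt i) \<Longrightarrow> w \<in> comp (rt j) \<Longrightarrow> i \<in> {0..p - 1} \<Longrightarrow> j \<in> {0..p - 1} \<Longrightarrow> i = j"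
  using root_unique[of "rt i" w "rt j"] rt_in_R by auto

text \<open>Branch vertices are attached to roots only, so siblings below any other vertex would be
  two balls in one urn of capacity one.\<close>

lemma starlike_subtree:
  assumes "i \<in> {0..p - 1}"
  shows "starlike (subtree F i) (rt i)"
  unfolding subtree_eq[OF assms] parent_tree.starlike_iff[OF tree[OF assms]]
proof (intro ballI impI)
  fix v w
  assume v: "v \<in> comp (rt i) - {rt i}" and w: "w \<in> comp (rt i) - {rt i}"
    and "par v = par w \<and> par v \<noteq> rt i"
  then have eq: "par v = par w" and nr: "par v \<notin> R"
    using comp_parent_root[OF assms v] by auto
  have ball: "\<exists>m\<in>{1..p}. u = ball_vertex k m \<and> d m \<noteq> 0"
    if u: "u \<in> V - R" "par u \<notin> R" for u
    using u(1)
  proof (cases rule: nonroots)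
    case (ball m)
    have "d m \<noteq> 0"
      using u(2) ball par_ball[of m] rt_in_R[of 0] by (cases "d m") auto
    with ball show ?thesis
      by blast
  next
    case (branch j r)
    then show ?thesis
      using u(2) by (auto simp: forest_parent_branch forest_roots_def)
  qed
  obtain m where m: "m \<in> {1..p}" "v = ball_vertex k m" "d m \<noteq> 0"
    using ball[OF comp_nonroot(1)[OF assms v] nr] by blast
  obtain n where n: "n \<in> {1..p}" "w = ball_vertex k n"
    using ball[OF comp_nonroot(1)[OF assms w]] nr unfolding eq by blast
  have "int (d m) = int (d n)"
    using eq unfolding m(2) n(2) par_ball[OF m(1)] par_ball[OF n(1)] .
  then show "v = w"
    using d_inj[OF m(1) n(1) _ m(3)] m(2) n(2) by simp
qed

lemma forest_of_dist_forest: "forest_of p k d F"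
  unfolding forest_of_def
proof (intro conjI ballI impI)
  have vs: "verts (subtree F i) = comp (rt i)" if "i \<in> {0..p - 1}" for i
    using subtree_eq[OF that] by simp
  show "verts F = {0..(int p - 1) * int k + 1} \<union> rt ` {1..p - 1}"
    by (simp add: F_eq forest_verts_def)
  have "V = (\<Union>i\<in>{0..p - 1}. comp (rt i))"
  proof (intro equalityI subsetI)
    fix w assume "w \<in> V"
    then obtain i where "i \<in> {0..p - 1}" "w \<in> comp (rt i)"
      using ex_comp by blast
    then show "w \<in> (\<Union>i\<in>{0..p - 1}. comp (rt i))"
      by blast
  next
    fix w assume "w \<in> (\<Union>i\<in>{0..p - 1}. comp (rt i))"
    then show "w \<in> V"
      using comp_subset by blast
  qed
  then show "verts F = (\<Union>i\<in>{0..p - 1}. verts (subtree F i))"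
    by (simp add: verts_F vs)
  have "V - R = (\<Union>i\<in>{0..p - 1}. comp (rt i) - {rt i})"
  proof (intro equalityI subsetI)
    fix w assume w: "w \<in> V - R"
    then obtain i where "i \<in> {0..p - 1}" "w \<in> comp (rt i)"
      using ex_comp by blast
    with w show "w \<in> (\<Union>i\<in>{0..p - 1}. comp (rt i) - {rt i})"
      using rt_in_R by blast
  next
    fix w assume "w \<in> (\<Union>i\<in>{0..p - 1}. comp (rt i) - {rt i})"
    then show "w \<in> V - R"
      using comp_nonroot(1) by blast
  qed
  then show "edges F = (\<Union>i\<in>{0..p - 1}. edges (subtree F i))"
    by (simp add: edges_F subtree_eq edges_parent_graph image_UN)
  show "disjoint_family_on (\<lambda>i. verts (subtree F i)) {0..p - 1}"
    unfolding disjoint_family_on_def using vs comp_unique by blast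
  show "children (subtree F i) (rt i) (rt i) = {(int i - 1) * int k + 2..int i * int k}"
    if i: "i \<in> {1..p - 1}" for i
  proof -
    have i': "i \<in> {0..p - 1}"
      using i by simp
    show ?thesis
      unfolding branch_vertices_eq children_subtree[OF i']
    proof (intro equalityI subsetI)
      fix w assume w: "w \<in> {w \<in> comp (rt i) - {rt i}. par w = rt i}"
      then have "w \<in> V - R"
        using comp_nonroot(1)[OF i'] by blast
      then show "w \<in> branch_vertex k i ` {1..k - 1}"
      proof (cases rule: nonroots)
        case (ball m)
        then show ?thesis
          using w i by (simp add: par_ball rt_def)
      next
        case (branch j r)
        then show ?thesis
          using w by (simp add: forest_parent_branch)
      qed
    next
      fix w assume "w \<in> branch_vertex k i ` {1..k - 1}"
      then show "w \<in> {w \<in> comp (rt i) - {rt i}. par w = rt i}"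
        using nonroot_in_comp[OF i'] branch_nonroot[OF i] forest_parent_branch by auto
    qed
  qed
  show "ball_vertex k m \<in> children (subtree F 0) 0 0" if "m \<in> {1..p}" "d m = 0" for m
    using nonroot_in_comp[of 0 "ball_vertex k m"] ball_nonroot[of m] that
    by (simp add: children_subtree[of 0, simplified] par_ball)
  show "\<exists>i\<in>{0..p - 1}. ball_vertex k m \<in> children (subtree F i) (rt i) (int (d m))"
    if "m \<in> {1..p}" "1 \<le> d m" for m
  proof -
    have b: "ball_vertex k m \<in> V - R"
      using ball_nonroot that by blast
    then obtain i where i: "i \<in> {0..p - 1}" "ball_vertex k m \<in> comp (rt i)"
      using ex_comp by blast
    moreover have "ball_vertex k m \<noteq> rt i"
      using b i rt_in_R by auto
    ultimately show ?thesis
      using that(1) by (auto simp: children_subtree par_ball)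
  qed
  fix i assume i: "i \<in> {0..p - 1}"
  show "rt i = Min (verts (subtree F i))"
    using Min_comp_root[OF rt_in_R[OF i]] by (simp add: vs[OF i])
  show "increasing_tree (verts (subtree F i)) (subtree F i)"
    unfolding subtree_eq[OF i] verts_parent_graph
    by (rule parent_tree.increasing) (rule tree[OF i])
  show "starlike (subtree F i) (rt i)"
    by (rule starlike_subtree[OF i])
qed

end

text \<open>Each tree of \<open>F\<close> has a parent function of its own. The conditions on
  children prescribe the parent of every ball and of every branch vertex, so all these functions
  agree with \<open>forest_parent k d\<close>.\<close>

lemma forest_of_imp_dist_forest:
  assumes p: "p \<ge> 1" and k: "k \<ge> 1" and "forest_of p k d F"
  shows "F = dist_forest p k d"
proof -
  let ?I = "{0..p - 1}" and ?S = "subtree F" and ?par = "forest_parent k d"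
  let ?V = "forest_verts p k" and ?R = "forest_roots p"
  note forest = assms(3)[unfolded forest_of_def]
  have verts: "verts F = ?V" and verts_Un: "verts F = (\<Union>i\<in>?I. verts (?S i))"
    using forest by (auto simp: forest_verts_def)
  have ball_0: "ball_vertex k m \<in> children (?S 0) 0 0" if "m \<in> {1..p}" "d m = 0" for m
    using forest that by blast
  have ball_pos: "\<exists>j\<in>?I. ball_vertex k m \<in> children (?S j) (rt j) (int (d m))"
    if "m \<in> {1..p}" "d m \<ge> 1" for m
    using forest that by blast
  have disj: "i = j" if "w \<in> verts (?S i)" "w \<in> verts (?S j)" "i \<in> ?I" "j \<in> ?I" for w i j
    using forest that unfolding disjoint_family_on_def by blast
  have "\<exists>f. parent_tree (verts (?S i)) (rt i) f \<and> ?S i = parent_graph (verts (?S i)) {rt i} f"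
    if "i \<in> ?I" for i
  proof -
    have "increasing_tree (verts (?S i)) (?S i)" "rt i = Min (verts (?S i))"
      using forest that by blast+
    then show ?thesis
      using increasing_tree_parent by metis
  qed
  then obtain f where f: "\<And>i. i \<in> ?I \<Longrightarrow> parent_tree (verts (?S i)) (rt i) (f i)"
    "\<And>i. i \<in> ?I \<Longrightarrow> ?S i = parent_graph (verts (?S i)) {rt i} (f i)"
    by metis
  have ch: "children (?S i) (rt i) u = {w \<in> verts (?S i) - {rt i}. f i w = u}" if "i \<in> ?I" for i u
    using parent_tree.children_eq[OF f(1)[OF that]] f(2)[OF that] by metis
  have root_in: "rt i \<in> verts (?S i)" if "i \<in> ?I" for i
    using parent_forest.roots[OF f(1)[OF that, unfolded parent_tree_def]] by simp
  have nonroot: "w \<in> ?V - ?R" if "i \<in> ?I" "w \<in> verts (?S i) - {rt i}" for i w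
  proof -
    have "w \<noteq> rt j" if "j \<in> ?I" for j
      using that \<open>i \<in> ?I\<close> \<open>w \<in> verts (?S i) - {rt i}\<close> root_in[OF that] disj[of w i j] by auto
    then have "w \<notin> ?R"
      unfolding forest_roots_def by blast
    then show ?thesis
      using that verts verts_Un by blast
  qed
  have par: "f i w = ?par w" if i: "i \<in> ?I" and w: "w \<in> verts (?S i) - {rt i}" for i w
    using p k nonroot[OF i w]
  proof (cases rule: nonroot_cases)
    case (ball m)
    have "\<exists>j\<in>?I. w \<in> children (?S j) (rt j) (int (d m))"
    proof (cases "d m = 0")
      case True
      then have "w \<in> children (?S 0) (rt 0) (int (d m))"
        using ball_0 ball by simp
      then show ?thesis
        by (intro bexI[of _ 0]) auto
    next
      case False
      then show ?thesis
        using ball_pos ball by simp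
    qed
    \<comment> \<open>The conditions name the parent of \<open>w\<close> in some tree
      \<open>j\<close>; disjointness identifies it with the tree \<open>i\<close> that contains
      \<open>w\<close>.\<close>
    then obtain j where j: "j \<in> ?I" "w \<in> verts (?S j)" "f j w = int (d m)"
      using ch by blast
    then show ?thesis
      using disj[of w i j] i w ball k by (simp add: forest_parent_ball)
  next
    case (branch j r)
    then have "w \<in> {(int j - 1) * int k + 2..int j * int k}"
      unfolding branch_vertices_eq by simp
    then have "w \<in> children (?S j) (rt j) (rt j)"
      using forest branch(1) by blast
    then have "w \<in> verts (?S j)" "f j w = rt j"
      using ch[of j] branch(1) by auto
    then show ?thesis
      using disj[of w i j] i w branch by (simp add: forest_parent_branch)
  qed
  have "edges F = (\<Union>i\<in>?I. edges (?S i))"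
    using forest by blast
  also have "\<dots> = (\<Union>i\<in>?I. (\<lambda>v. {?par v, v}) ` (verts (?S i) - {rt i}))"
  proof (rule SUP_cong[OF refl])
    fix i assume i: "i \<in> ?I"
    have "edges (?S i) = (\<lambda>v. {f i v, v}) ` (verts (?S i) - {rt i})"
      using f(2)[OF i] edges_parent_graph by metis
    also have "\<dots> = (\<lambda>v. {?par v, v}) ` (verts (?S i) - {rt i})"
      using par[OF i] by (intro image_cong) auto
    finally show "edges (?S i) = (\<lambda>v. {?par v, v}) ` (verts (?S i) - {rt i})" .
  qed
  also have "\<dots> = (\<lambda>v. {?par v, v}) ` (\<Union>i\<in>?I. verts (?S i) - {rt i})"
    by (simp add: image_UN)
  also have "(\<Union>i\<in>?I. verts (?S i) - {rt i}) = ?V - ?R"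
  proof (intro equalityI subsetI)
    fix w assume w: "w \<in> ?V - ?R"
    then obtain i where i: "i \<in> ?I" "w \<in> verts (?S i)"
      using verts verts_Un by blast
    then have "w \<noteq> rt i"
      using w by (auto simp: forest_roots_def)
    with i show "w \<in> (\<Union>i\<in>?I. verts (?S i) - {rt i})"
      by blast
  next
    fix w assume "w \<in> (\<Union>i\<in>?I. verts (?S i) - {rt i})"
    then show "w \<in> ?V - ?R"
      using nonroot by blast
  qed
  finally show ?thesis
    using verts by (cases F) (simp add: dist_forest_def parent_graph_def)
qed

lemma pk_forests_eq:
  assumes "p \<ge> 1" "k \<ge> 1"
  shows "pk_forests p k = dist_forest p k ` distributions p k"
  using distribution.forest_of_dist_forest[unfolded distribution_def] forest_of_imp_dist_forest assms
  unfolding pk_forests_def by blast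

lemma inj_on_dist_forest:
  assumes "p \<ge> 1" "k \<ge> 1"
  shows "inj_on (dist_forest p k) (distributions p k)"
proof (rule inj_onI)
  fix d d' assume d: "d \<in> distributions p k" "d' \<in> distributions p k"
    and eq: "dist_forest p k d = dist_forest p k d'"
  interpret D: distribution p k d
    using assms d by unfold_locales
  interpret D': distribution p k d'
    using assms d by unfold_locales
  have "d m = d' m" if m: "m \<in> {1..p}" for m
  proof -
    have "D.par (ball_vertex k m) = D'.par (ball_vertex k m)"
      using parent_graph_inject[OF D.parent_forest_axioms D'.parent_forest_axioms] eq D.ball_nonroot[OF m]
      by (auto simp: dist_forest_def)
    then show ?thesis
      using m by (simp add: D.par_ball D'.par_ball)
  qed
  moreover have "d \<in> extensional {1..p}" "d' \<in> extensional {1..p}"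
    using d by (auto simp: distributions_def PiE_iff)
  ultimately show "d = d'"
    by (intro extensionalityI)
qed

lemma (in distribution) card_children_subtree_0:
  "card (children (subtree F 0) 0 0) = card {i \<in> {1..p}. d i = 0}"
proof -
  have "children (subtree F 0) 0 0 = ball_vertex k ` {i \<in> {1..p}. d i = 0}"
  proof (intro equalityI subsetI)
    fix w assume "w \<in> children (subtree F 0) 0 0"
    then have w: "w \<in> comp (rt 0) - {rt 0}" "par w = 0"
      using children_subtree[of 0 0] by auto
    from comp_nonroot(1)[OF _ w(1)] have "w \<in> V - R"
      by simp
    then show "w \<in> ball_vertex k ` {i \<in> {1..p}. d i = 0}"
    proof (cases rule: nonroots)
      case (ball m)
      then show ?thesis
        using w by (simp add: par_ball)
    next
      case (branch i r)
      then show ?thesis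
        using w by (simp add: forest_parent_branch rt_def)
    qed
  next
    fix w assume "w \<in> ball_vertex k ` {i \<in> {1..p}. d i = 0}"
    then show "w \<in> children (subtree F 0) 0 0"
      using forest_of_dist_forest unfolding forest_of_def by blast
  qed
  moreover have "inj_on (ball_vertex k) A" for A
    using k_pos by (auto simp: inj_on_def ball_vertex_eq_iff)
  ultimately show ?thesis
    by (simp add: card_image)
qed

section \<open>Injectivity of \<open>Xi\<close>\<close>

text \<open>A chain is determined by its vertex set: the parent of \<open>b\<close> is the only element below \<open>b\<close> that
  is not the parent of a smaller element.\<close>

lemma chain_parent_unique:
  fixes A :: "'a::linorder set"
  assumes "finite A"
    and f: "\<And>b. b \<in> A - {a} \<Longrightarrow> f b \<in> A \<and> f b < b" "inj_on f (A - {a})"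
    and g: "\<And>b. b \<in> A - {a} \<Longrightarrow> g b \<in> A \<and> g b < b" "inj_on g (A - {a})"
    and "b \<in> A - {a}"
  shows "f b = g b"
  using assms(6)
proof (induction "card {x \<in> A. x < b}" arbitrary: b rule: less_induct)
  case less
  define B where "B = {x \<in> A - {a}. x < b}"
  have IH: "f x = g x" if "x \<in> B" for x
  proof (rule less.hyps)
    have "{y \<in> A. y < x} \<subset> {y \<in> A. y < b}"
      using that by (auto simp: B_def)
    then show "card {y \<in> A. y < x} < card {y \<in> A. y < b}"
      using assms(1) by (intro psubset_card_mono) auto
  qed (use that in \<open>auto simp: B_def\<close>)
  show ?case
  proof (rule ccontr)
    assume neq: "f b \<noteq> g b"
    have finB: "finite B"
      using assms(1) by (simp add: B_def)
    have "f b \<notin> f ` B"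
      using inj_onD[OF f(2)] less.prems by (auto simp: B_def)
    moreover have "g b \<notin> f ` B"
    proof
      assume "g b \<in> f ` B"
      then obtain x where "x \<in> B" "g b = g x"
        using IH by auto
      then show False
        using inj_onD[OF g(2), of b x] less.prems by (auto simp: B_def)
    qed
    moreover have "card (f ` B) = card B"
      by (rule card_image) (use f(2) in \<open>auto simp: B_def inj_on_def\<close>)
    \<comment> \<open>Neither \<open>f b\<close> nor \<open>g b\<close> is a value of
      \<open>f\<close> on \<open>B\<close>, so \<open>insert a B\<close>, of size at most
      \<open>card B + 1\<close>, would contain \<open>card B + 2\<close> elements.\<close>
    ultimately have "card (insert (f b) (insert (g b) (f ` B))) = card B + 2"
      using finB neq by simp
    moreover have "insert (f b) (insert (g b) (f ` B)) \<subseteq> insert a B"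
    proof -
      have "f x \<in> insert a B" if "x \<in> B" for x
        using f(1)[of x] that by (auto simp: B_def)
      moreover have "f b \<in> insert a B" "g b \<in> insert a B"
        using f(1)[of b] g(1)[of b] less.prems by (auto simp: B_def)
      ultimately show ?thesis
        by blast
    qed
    then have "card (insert (f b) (insert (g b) (f ` B))) \<le> card (insert a B)"
      using finB by (intro card_mono) auto
    moreover have "card (insert a B) \<le> card B + 1"
      using finB by (simp add: card_insert_if)
    ultimately show False
      by simp
  qed
qed

section \<open>The tree and the colouring obtained from a forest\<close>

context distribution
begin

text \<open>Index of the tree that contains the vertex of ball \<open>v\<close>; it becomes the
  parent of \<open>v\<close> in the tree of \<open>Omega\<close>. For \<open>v \<in> {1..p}\<close>
  it is unique by \<open>comp_unique\<close>.\<close>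

definition own :: "nat \<Rightarrow> nat" where
  "own v = (SOME i. i \<in> {0..p - 1} \<and> ball_vertex k v \<in> comp (rt i))"

lemma own:
  assumes "v \<in> {1..p}"
  shows "own v \<in> {0..p - 1}" "ball_vertex k v \<in> comp (rt (own v))"
proof -
  have "ball_vertex k v \<in> V"
    using ball_nonroot[OF assms] by blast
  then have "\<exists>i. i \<in> {0..p - 1} \<and> ball_vertex k v \<in> comp (rt i)"
    using ex_comp by blast
  then have "own v \<in> {0..p - 1} \<and> ball_vertex k v \<in> comp (rt (own v))"
    unfolding own_def by (rule someI_ex)
  then show "own v \<in> {0..p - 1}" "ball_vertex k v \<in> comp (rt (own v))"
    by blast+
qed

lemma own_eqI:
  assumes "v \<in> {1..p}" "i \<in> {0..p - 1}" "ball_vertex k v \<in> comp (rt i)"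
  shows "own v = i"
  using comp_unique[OF own(2)[OF assms(1)] assms(3) own(1)[OF assms(1)] assms(2)] .

text \<open>Two children of \<open>rt i\<close> that both lead to \<open>w\<close> would be
  comparable, but the parent of a branch vertex is a root, so none is a descendant of
  another.\<close>

lemma branch_unique:
  assumes "i \<in> {1..p - 1}" "r \<in> {1..k - 1}" "s \<in> {1..k - 1}"
    "step\<^sup>*\<^sup>* (branch_vertex k i r) w" "step\<^sup>*\<^sup>* (branch_vertex k i s) w"
  shows "r = s"
proof -
  have eq: "r = s" if rs: "r \<in> {1..k - 1}" "s \<in> {1..k - 1}"
    and "step\<^sup>*\<^sup>* (branch_vertex k i r) (branch_vertex k i s)" for r s
    using that(3)
  proof (cases rule: rtranclp.cases)
    case rtrancl_refl
    then show ?thesis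
      by (simp add: branch_vertex_def)
  next
    case (rtrancl_into_rtrancl y)
    then have "y = rt i"
      using rs by (simp add: step_def forest_parent_branch)
    then have "y \<in> R"
      using assms(1) rt_in_R[of i] by simp
    then have "branch_vertex k i r \<in> R"
      using reach_root[OF rtrancl_into_rtrancl(1)] by simp
    then show ?thesis
      using branch_nonroot[OF assms(1) rs(1)] by blast
  qed
  show ?thesis
    using reach_linear[OF assms(4,5)] eq assms(2,3) by metis
qed

lemma ex_branch:
  assumes "i \<in> {1..p - 1}" "w \<in> comp (rt i) - {rt i}"
  obtains r where "r \<in> {1..k - 1}" "step\<^sup>*\<^sup>* (branch_vertex k i r) w"
proof -
  have "step\<^sup>+\<^sup>+ (rt i) w"
    using assms(2) rtranclpD[of step "rt i" w] by auto
  then obtain c where c: "step (rt i) c" "step\<^sup>*\<^sup>* c w"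
    by (meson tranclpD)
  then have "c \<in> V - R" "par c = rt i"
    by (auto simp: step_def)
  then show ?thesis
  proof (cases rule: nonroots)
    case (ball m)
    then show ?thesis
      using assms(1) \<open>par c = rt i\<close> by (simp add: par_ball rt_def)
  next
    case (branch j r)
    then have "j = i"
      using \<open>par c = rt i\<close> by (simp add: forest_parent_branch)
    then show ?thesis
      using that[of r] branch c(2) by simp
  qed
qed

lemma branch_neq_ball:
  assumes "r \<in> {1..k - 1}" "m \<in> {1..p}"
  shows "branch_vertex k i r \<noteq> ball_vertex k m"
proof
  assume eq: "branch_vertex k i r = ball_vertex k m"
  have "(branch_vertex k i r - 1) mod int k = int r"
    using assms(1) by (auto simp: branch_vertex_def)
  moreover have "(ball_vertex k m - 1) mod int k = 0"
    by (simp add: ball_vertex_def)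
  ultimately show False
    using assms(1) eq by simp
qed

lemma branch_in_comp:
  assumes "i \<in> {1..p - 1}" "r \<in> {1..k - 1}"
  shows "branch_vertex k i r \<in> comp (rt i)"
  using nonroot_in_comp[of i "branch_vertex k i r"] branch_nonroot[OF assms] assms
  by (simp add: forest_parent_branch)

text \<open>This makes the tree of \<open>Omega\<close> increasing. For \<open>i = own v > 0\<close>
  the way from \<open>rt i\<close> to the ball passes a branch vertex with \<open>r \<ge> 1\<close>,
  so \<open>(i - 1) * k + r \<le> (v - 1) * k\<close> and hence \<open>i < v\<close>.\<close>

lemma own_less:
  assumes "v \<in> {1..p}"
  shows "own v < v"
proof (cases "own v = 0")
  case False
  then have i: "own v \<in> {1..p - 1}"
    using own(1)[OF assms] by simp
  have "ball_vertex k v \<noteq> rt (own v)"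
    using ball_nonroot[OF assms] rt_in_R[OF own(1)[OF assms]] by auto
  then obtain r where r: "r \<in> {1..k - 1}" "step\<^sup>*\<^sup>* (branch_vertex k (own v) r) (ball_vertex k v)"
    using ex_branch[OF i] own(2)[OF assms] by blast
  then have "branch_vertex k (own v) r \<le> ball_vertex k v"
    using reach_le by blast
  then have "(int (own v) - 1) * int k + int r \<le> (int v - 1) * int k"
    by (simp add: branch_vertex_def ball_vertex_def)
  moreover have "int r > 0"
    using r by simp
  ultimately have "(int (own v) - 1) * int k < (int v - 1) * int k"
    by linarith
  then show ?thesis
    using k_pos by simp
qed (use assms in simp)

sublocale T: parent_tree "{0..p}" 0 own
proof
  fix v assume "v \<in> {0..p} - {0}"
  then have "v \<in> {1..p}"
    by auto
  then show "own v \<in> {0..p}" "own v < v"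
    using own_less own(1) by fastforce+
qed auto

lemma edges_T: "edges T.G = (\<lambda>v. {own v, v}) ` {1..p}"
proof -
  have "{0..p} - {0} = {1..p}"
    by auto
  then show ?thesis
    by (simp only: edges_parent_graph)
qed

lemma verts_subtree: "i \<in> {0..p - 1} \<Longrightarrow> verts (subtree F i) = comp (rt i)"
  by (simp add: subtree_eq)

text \<open>\<open>omega_tree\<close> and \<open>omega_edge\<close> ask only for
  \<open>v > 0\<close>; membership in the forest bounds \<open>v\<close> by
  \<open>p\<close>.\<close>

lemma ball_in_comp_iff:
  assumes "i \<in> {0..p - 1}"
  shows "v > 0 \<and> ball_vertex k v \<in> comp (rt i) \<longleftrightarrow> v \<in> {1..p} \<and> own v = i"
proof
  assume v: "v > 0 \<and> ball_vertex k v \<in> comp (rt i)"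
  then have "ball_vertex k v \<in> V"
    using comp_subset[OF assms] by blast
  moreover have "ball_vertex k v \<ge> 1"
    using v by (intro ball_vertex_pos) simp
  ultimately have "ball_vertex k v \<le> (int p - 1) * int k + 1"
    by (auto simp: forest_verts_def rt_def)
  then have "v \<in> {1..p}"
    using v k_pos by (simp add: ball_vertex_le_iff)
  then show "v \<in> {1..p} \<and> own v = i"
    using own_eqI[OF _ assms] v by blast
qed (use own in auto)

lemma omega_tree_eq: "omega_tree p k F = T.G"
proof -
  have "{{0, v} |v. v > 0 \<and> ball_vertex k v \<in> verts (subtree F 0)} \<union>
      {{i, v} |i v. i \<in> {1..p - 1} \<and> v > 0 \<and> ball_vertex k v \<in> verts (subtree F i)} =
      edges T.G" (is "?A \<union> ?B = ?C")
  proof (intro equalityI subsetI)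
    fix e assume "e \<in> ?A \<union> ?B"
    then obtain i v where i: "i \<in> {0..p - 1}" and e: "e = {i, v}"
      and v: "v > 0 \<and> ball_vertex k v \<in> verts (subtree F i)"
      by fastforce
    then have "v \<in> {1..p}" "own v = i"
      using ball_in_comp_iff[OF i] verts_subtree[OF i] by auto
    then show "e \<in> ?C"
      using e edges_T by auto
  next
    fix e assume "e \<in> ?C"
    then obtain v where v: "v \<in> {1..p}" "e = {own v, v}"
      using edges_T by auto
    then have *: "v > 0 \<and> ball_vertex k v \<in> verts (subtree F (own v))"
      using ball_in_comp_iff[of "own v" v] own[of v] verts_subtree by auto
    show "e \<in> ?A \<union> ?B"
    proof (cases "own v = 0")
      case True
      then have "e \<in> ?A"
        using * v by auto
      then show ?thesis ..
    next
      case False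
      then have "own v \<in> {1..p - 1}"
        using own(1)[OF v(1)] by simp
      then have "e \<in> ?B"
        using * v by blast
      then show ?thesis ..
    qed
  qed
  then show ?thesis
    unfolding omega_tree_def by (simp add: parent_graph_def)
qed

definition col :: "nat \<Rightarrow> nat" where
  "col v = (if own v = 0 then 0 else
     (THE r. r \<in> {1..k - 1} \<and> step\<^sup>*\<^sup>* (branch_vertex k (own v) r) (ball_vertex k v)))"

lemma col_pos:
  assumes "v \<in> {1..p}" "own v \<noteq> 0"
  shows "col v \<in> {1..k - 1}" "step\<^sup>*\<^sup>* (branch_vertex k (own v) (col v)) (ball_vertex k v)"
proof -
  have i: "own v \<in> {1..p - 1}"
    using own(1)[OF assms(1)] assms(2) by simp
  have "ball_vertex k v \<noteq> rt (own v)"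
    using ball_nonroot[OF assms(1)] rt_in_R[OF own(1)[OF assms(1)]] by auto
  then obtain r where r: "r \<in> {1..k - 1}" "step\<^sup>*\<^sup>* (branch_vertex k (own v) r) (ball_vertex k v)"
    using ex_branch[OF i] own(2)[OF assms(1)] by blast
  then have "col v = r"
    unfolding col_def using assms(2) branch_unique[OF i] by auto
  with r show "col v \<in> {1..k - 1}" "step\<^sup>*\<^sup>* (branch_vertex k (own v) (col v)) (ball_vertex k v)"
    by auto
qed

lemma col_eqI:
  assumes "v \<in> {1..p}" "i \<in> {1..p - 1}" "r \<in> {1..k - 1}"
    "step\<^sup>*\<^sup>* (branch_vertex k i r) (ball_vertex k v)"
  shows "own v = i" "col v = r"
proof -
  have "ball_vertex k v \<in> comp (rt i)"
    using branch_in_comp[OF assms(2,3)] assms(4) by auto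
  then show "own v = i"
    using own_eqI assms(1,2) by simp
  then show "col v = r"
    using branch_unique[OF assms(2) col_pos(1) assms(3) _ assms(4)] col_pos(2) assms(1,2) by auto
qed

text \<open>An edge is an unordered pair, so it might match the rules in several ways. As
  \<open>own w < w\<close>, its larger element must be the child, and \<open>branch_unique\<close>
  fixes the colour. This justifies the \<open>THE\<close> in \<open>Omega\<close>.\<close>

lemma omega_edge_iff:
  assumes "v \<in> {1..p}"
  shows "omega_edge p k F {own v, v} c \<longleftrightarrow> c = col v"
proof
  assume "omega_edge p k F {own v, v} c"
  then show "c = col v"
  proof cases
    case (root w)
    then have w: "w \<in> {1..p}" "own w = 0"
      using ball_in_comp_iff[of 0 w] verts_subtree[of 0] by auto
    then have "w = v"
      using root(1) own_less[OF assms] by (auto simp: doubleton_eq_iff)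
    then show ?thesis
      using w root by (simp add: col_def)
  next
    case (inner i w)
    then have w: "w \<in> {1..p}" "own w = i"
      using ball_in_comp_iff[of i w] verts_subtree[of i] by auto
    then have "w = v"
      using inner(1) own_less[OF assms] own_less[OF w(1)] by (auto simp: doubleton_eq_iff)
    have "i \<in> {0..p - 1}"
      using inner by simp
    have "ancestor (component G (rt i)) (rt i) (branch_vertex k i c) (ball_vertex k w)"
      using inner(6) unfolding subtree_def F_eq branch_vertex_def .
    then have "step\<^sup>+\<^sup>+ (branch_vertex k i c) (ball_vertex k w)"
      using ancestor_component[OF rt_in_R[OF \<open>i \<in> {0..p - 1}\<close>]] by simp
    then show ?thesis
      using col_eqI(2)[OF w(1) inner(2) inner(5)] \<open>w = v\<close> by (simp add: tranclp_into_rtranclp)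
  qed
next
  assume c: "c = col v"
  show "omega_edge p k F {own v, v} c"
  proof (cases "own v = 0")
    case True
    have "omega_edge p k F {0, v} 0"
      using omega_edge.root ball_in_comp_iff[of 0 v] verts_subtree[of 0] assms True by auto
    then show ?thesis
      using True c by (simp add: col_def)
  next
    case False
    let ?i = "own v"
    have i: "?i \<in> {1..p - 1}" and i': "?i \<in> {0..p - 1}"
      using False own(1)[OF assms] by auto
    let ?b = "branch_vertex k ?i c"
    have "step\<^sup>*\<^sup>* (rt ?i) ?b" "step\<^sup>*\<^sup>* ?b (ball_vertex k v)"
      using branch_in_comp[OF i] col_pos[OF assms False] c by auto
    moreover have "?b \<noteq> ball_vertex k v"
      using branch_neq_ball col_pos[OF assms False] assms c by blast
    ultimately have "ancestor (component G (rt ?i)) (rt ?i) ?b (ball_vertex k v)"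
      using ancestor_component[OF rt_in_R[OF i']] by (metis rtranclpD)
    then have "ancestor (subtree F ?i) (rt ?i) ((int ?i - 1) * int k + int c + 1) (ball_vertex k v)"
      unfolding subtree_def F_eq branch_vertex_def .
    moreover have "v > 0 \<and> ball_vertex k v \<in> verts (subtree F ?i)"
      using own(2)[OF assms] verts_subtree[OF i'] assms by simp
    ultimately show ?thesis
      using omega_edge.inner[of ?i p v k F c] i col_pos(1)[OF assms False] c by simp
  qed
qed

lemma Omega_eq:
  "fst (Omega p k F) = T.G"
  "v \<in> {1..p} \<Longrightarrow> snd (Omega p k F) {own v, v} = col v"
  "snd (Omega p k F) \<in> extensional (edges T.G)"
proof -
  show "snd (Omega p k F) {own v, v} = col v" if v: "v \<in> {1..p}"
  proof -
    have "{own v, v} \<in> edges T.G"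
      using v by (auto simp: edges_T)
    moreover have "(THE c. omega_edge p k F {own v, v} c) = col v"
      by (simp add: omega_edge_iff[OF v])
    ultimately show ?thesis
      by (simp add: Omega_def omega_tree_eq)
  qed
qed (simp_all add: Omega_def omega_tree_eq)

lemma own_eq_0_iff: "{0, v} \<in> edges T.G \<longleftrightarrow> v \<in> {1..p} \<and> own v = 0"
proof (cases "v = 0")
  case True
  \<comment> \<open>For \<open>v = 0\<close> the pair \<open>{0, v}\<close> collapses to a
    singleton, which is not an edge.\<close>
  have "{own w, w} \<noteq> {0}" if "w \<in> {1..p}" for w
    using own_less[OF that] by auto
  then have "{0} \<notin> edges T.G"
    unfolding edges_T by blast
  then show ?thesis
    using True by simp
next
  case False
  then show ?thesis
    using T.edge_iff[of 0 v] by auto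
qed

text \<open>Branch vertices hang below some \<open>rt i\<close> with \<open>i \<ge> 1\<close>, so
  the tree at \<open>0\<close> has only ball vertices besides its root. Its vertex set is the one
  demanded in \<open>triples\<close>.\<close>

lemma comp_0_eq: "comp 0 = {0} \<union> {ball_vertex k v |v. {0, v} \<in> edges T.G}"
proof (intro equalityI subsetI)
  fix w assume w: "w \<in> comp 0"
  show "w \<in> {0} \<union> {ball_vertex k v |v. {0, v} \<in> edges T.G}"
  proof (cases "w = 0")
    case False
    then have w': "w \<in> comp (rt 0) - {rt 0}"
      using w by simp
    then have "w \<in> V - R"
      using comp_nonroot(1)[of 0 w] by simp
    then show ?thesis
    proof (cases rule: nonroots)
      case (ball m)
      then have "own m = 0"
        using own_eqI[of m 0] w by simp
      then show ?thesis
        using ball own_eq_0_iff by blast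
    next
      case (branch i r)
      then have "w \<in> comp (rt i)"
        using branch_in_comp by blast
      then have "i = 0"
        using comp_unique[of w i 0] w branch by auto
      then show ?thesis
        using branch by simp
    qed
  qed simp
next
  fix w assume "w \<in> {0} \<union> {ball_vertex k v |v. {0, v} \<in> edges T.G}"
  then consider "w = 0" | v where "w = ball_vertex k v" "v \<in> {1..p}" "own v = 0"
    using own_eq_0_iff by blast
  then show "w \<in> comp 0"
    using own(2) by cases (auto, force)
qed

lemma Xi_in_triples: "Xi p k F \<in> triples p k"
proof -
  have col: "col v < k" "col v = 0 \<longleftrightarrow> own v = 0" if "v \<in> {1..p}" for v
    using col_pos(1)[OF that] k_pos by (cases "own v = 0"; force simp: col_def)+
  have "snd (Omega p k F) e \<in> {0..<k} \<and> (snd (Omega p k F) e = 0 \<longleftrightarrow> 0 \<in> e)"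
    if e: "e \<in> edges T.G" for e
  proof -
    obtain v where v: "v \<in> {1..p}" "e = {own v, v}"
      using e by (auto simp: edges_T)
    then show ?thesis
      using col[OF v(1)] Omega_eq(2)[OF v(1)] by auto
  qed
  then have "snd (Omega p k F) \<in> colourings k T.G"
    using Omega_eq(3) by (auto simp: colourings_def PiE_iff)
  moreover have "increasing_tree ({0} \<union> {ball_vertex k v |v. {0, v} \<in> edges T.G}) (subtree F 0)"
    "starlike (subtree F 0) 0"
    using parent_tree.increasing[OF tree[of 0]] starlike_subtree[of 0] subtree_eq[of 0]
    unfolding comp_0_eq[symmetric] by simp_all
  moreover have "Xi p k F = ((T.G, snd (Omega p k F)), subtree F 0)"
    using Omega_eq(1) by (simp add: Xi_def prod_eq_iff)
  ultimately show ?thesis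
    using T.increasing by (simp add: triples_def)
qed

text \<open>Every other branch vertex has a root as its parent and cannot occur inside this path, so
  the rest of the path consists of balls. The right-hand side depends only on \<open>own\<close> and
  \<open>col\<close>, that is, on the image under \<open>Omega\<close>.\<close>

lemma chain_eq:
  assumes "i \<in> {1..p - 1}" "r \<in> {1..k - 1}"
  shows "comp (branch_vertex k i r) =
    insert (branch_vertex k i r) (ball_vertex k ` {v \<in> {1..p}. own v = i \<and> col v = r})"
proof (intro equalityI subsetI)
  let ?b = "branch_vertex k i r"
  fix w assume w: "w \<in> comp ?b"
  show "w \<in> insert ?b (ball_vertex k ` {v \<in> {1..p}. own v = i \<and> col v = r})"
  proof (cases "w = ?b")
    case False
    have "step\<^sup>*\<^sup>* ?b w"
      using w by simp
    then obtain y where y: "step\<^sup>*\<^sup>* ?b y" "step y w"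
      using False by (cases rule: rtranclp.cases) auto
    then have "w \<in> V - R" and par: "par w = y"
      by (auto simp: step_def)
    from this(1) show ?thesis
    proof (cases rule: nonroots)
      case (ball m)
      then have "own m = i" "col m = r"
        using col_eqI[OF ball(1) assms] w by auto
      then show ?thesis
        using ball by blast
    next
      case (branch j s)
      then have "y \<in> R"
        using par by (auto simp: forest_parent_branch forest_roots_def)
      then have "?b \<in> R"
        using reach_root[OF y(1)] by simp
      then show ?thesis
        using branch_nonroot[OF assms] by blast
    qed
  qed simp
next
  fix w assume "w \<in> insert (branch_vertex k i r) (ball_vertex k ` {v \<in> {1..p}. own v = i \<and> col v = r})"
  then show "w \<in> comp (branch_vertex k i r)"
    using col_pos(2) assms by auto
qed

text \<open>These are the hypotheses of \<open>chain_parent_unique\<close>. Parents inside the chain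
  are at least the branch vertex, hence positive, so no ball of the chain lies in urn
  \<open>0\<close> and the capacity bound gives injectivity.\<close>

lemma chain_parent:
  assumes "i \<in> {1..p - 1}" "r \<in> {1..k - 1}"
  defines "A \<equiv> comp (branch_vertex k i r)"
  shows "finite A"
    "\<And>w. w \<in> A - {branch_vertex k i r} \<Longrightarrow> par w \<in> A \<and> par w < w"
    "inj_on par (A - {branch_vertex k i r})"
proof -
  let ?b = "branch_vertex k i r"
  show "finite A"
    unfolding A_def chain_eq[OF assms(1,2)] by simp
  show par: "par w \<in> A \<and> par w < w" if "w \<in> A - {?b}" for w
  proof -
    have "step\<^sup>*\<^sup>* ?b w" "w \<noteq> ?b"
      using that by (auto simp: A_def)
    then obtain y where "step\<^sup>*\<^sup>* ?b y" "step y w"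
      by (cases rule: rtranclp.cases) auto
    then show ?thesis
      using stepD[of y w] by (auto simp: A_def)
  qed
  have ball: "\<exists>m\<in>{1..p}. w = ball_vertex k m \<and> d m \<noteq> 0" if w: "w \<in> A - {?b}" for w
  proof -
    obtain m where m: "m \<in> {1..p}" "w = ball_vertex k m"
      using w unfolding A_def chain_eq[OF assms(1,2)] by blast
    have "?b \<le> par w"
      using par[OF w] reach_le by (auto simp: A_def)
    then have "d m \<noteq> 0"
      using branch_vertex_bounds(1)[OF assms(1,2)] m by (auto simp: par_ball)
    with m show ?thesis
      by blast
  qed
  show "inj_on par (A - {?b})"
  proof (rule inj_onI)
    fix v w assume v: "v \<in> A - {?b}" and w: "w \<in> A - {?b}" and eq: "par v = par w"
    obtain m n where m: "m \<in> {1..p}" "v = ball_vertex k m" "d m \<noteq> 0"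
      and n: "n \<in> {1..p}" "w = ball_vertex k n"
      using ball[OF v] ball[OF w] by blast
    have "int (d m) = int (d n)"
      using eq unfolding m(2) n(2) par_ball[OF m(1)] par_ball[OF n(1)] .
    then show "v = w"
      using d_inj[OF m(1) n(1) _ m(3)] m(2) n(2) by simp
  qed
qed

end

lemma inj_on_Xi:
  assumes "p \<ge> 1" "k \<ge> 1"
  shows "inj_on (Xi p k) (pk_forests p k)"
  unfolding pk_forests_eq[OF assms]
proof (rule inj_onI)
  fix F F' assume "F \<in> dist_forest p k ` distributions p k" "F' \<in> dist_forest p k ` distributions p k"
    and "Xi p k F = Xi p k F'"
  then obtain d d' where d: "d \<in> distributions p k" "d' \<in> distributions p k"
    and F: "F = dist_forest p k d" "F' = dist_forest p k d'"
    and eq: "Xi p k (dist_forest p k d) = Xi p k (dist_forest p k d')"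
    by blast
  interpret D: distribution p k d
    using assms d by unfold_locales
  interpret D': distribution p k d'
    using assms d by unfold_locales
  have Om: "Omega p k D.F = Omega p k D'.F" and S: "subtree D.F 0 = subtree D'.F 0"
    using eq by (auto simp: Xi_def)
  have T: "D.T.G = D'.T.G"
    using D.Omega_eq(1) D'.Omega_eq(1) Om by metis
  have own: "D.own v = D'.own v" if "v \<in> {1..p}" for v
    using parent_graph_inject[OF D.T.parent_forest_axioms D'.T.parent_forest_axioms T] that by auto
  have col: "D.col v = D'.col v" if "v \<in> {1..p}" for v
    using D.Omega_eq(2)[OF that] D'.Omega_eq(2)[OF that] Om own[OF that] by simp
  have "d v = d' v" if v: "v \<in> {1..p}" for v
  proof -
    let ?w = "ball_vertex k v"
    have "D.par ?w = D'.par ?w"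
    proof (cases "D.own v = 0")
      case True
      have comp: "D.comp 0 = D'.comp 0"
        using S D.verts_subtree[of 0] D'.verts_subtree[of 0] by simp
      have "parent_forest (D.comp 0) {0} D.par" "parent_forest (D.comp 0) {0} D'.par"
        using D.tree[of 0] D'.tree[of 0] comp by (auto simp: parent_tree_def)
      moreover have "parent_graph (D.comp 0) {0} D.par = parent_graph (D.comp 0) {0} D'.par"
        using S D.subtree_eq[of 0] D'.subtree_eq[of 0] comp by simp
      moreover have "?w \<in> D.comp 0 - {0}"
        using D.own(2)[OF v] True ball_vertex_pos[of v k] v by auto
      ultimately show ?thesis
        by (rule parent_graph_inject)
    next
      case False
      let ?b = "branch_vertex k (D.own v) (D.col v)"
      have i: "D.own v \<in> {1..p - 1}"
        using D.own(1)[OF v] False by simp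
      have r: "D.col v \<in> {1..k - 1}" "?w \<in> D.comp ?b"
        using D.col_pos[OF v False] by auto
      \<comment> \<open>\<open>own\<close> and \<open>col\<close> agree for both distributions, so
        by \<open>chain_eq\<close> the two chains through the ball have equal vertex sets.\<close>
      have "{u \<in> {1..p}. D.own u = D.own v \<and> D.col u = D.col v} =
          {u \<in> {1..p}. D'.own u = D.own v \<and> D'.col u = D.col v}"
        using own col by auto
      then have comp: "D.comp ?b = D'.comp ?b"
        unfolding D.chain_eq[OF i r(1)] D'.chain_eq[OF i r(1)] by simp
      have "?w \<in> D.comp ?b - {?b}"
        using r D.branch_neq_ball[OF r(1) v, of "D.own v"] by auto
      then show ?thesis
        using chain_parent_unique[OF D.chain_parent(1)[OF i r(1)] D.chain_parent(2)[OF i r(1)]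
            D.chain_parent(3)[OF i r(1)] D'.chain_parent(2,3)[OF i r(1), folded comp]] by blast
    qed
    then show ?thesis
      using v by (simp add: D.par_ball D'.par_ball)
  qed
  moreover have "d \<in> extensional {1..p}" "d' \<in> extensional {1..p}"
    using d by (auto simp: distributions_def PiE_iff)
  ultimately have "d = d'"
    by (intro extensionalityI)
  then show "F = F'"
    using F by simp
qed

section \<open>Counting triples\<close>

text \<open>The values allowed at \<open>i\<close> are the vertices below \<open>i\<close>.
  Splitting off \<open>Min V\<close> gives it the role of the distinguished value \<open>z\<close>
  in the counting lemmas, and extensionality makes the function unique for its tree.\<close>

definition parent_functions :: "'a::linorder set \<Rightarrow> ('a \<Rightarrow> 'a) set" where
  "parent_functions V = Pi\<^sub>E (V - {Min V}) (\<lambda>i. insert (Min V) {u \<in> V - {Min V}. u < i})"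

lemma parent_tree_if_parent_function:
  assumes "finite V" "V \<noteq> {}" "f \<in> parent_functions V"
  shows "parent_tree V (Min V) f"
proof
  show "finite V" "{Min V} \<subseteq> V"
    using assms by auto
  fix v assume v: "v \<in> V - {Min V}"
  then have "Min V < v"
    using assms(1) by (metis DiffE Min_le insertI1 le_neq_trans)
  moreover have "f v \<in> insert (Min V) {u \<in> V - {Min V}. u < v}"
    using assms(3) v by (auto simp: parent_functions_def)
  moreover have "Min V \<in> V"
    using assms by simp
  ultimately show "f v \<in> V" "f v < v"
    by auto
qed

lemma increasing_trees_eq:
  assumes "finite V" "V \<noteq> {}"
  shows "{T. increasing_tree V T} = parent_graph V {Min V} ` parent_functions V"
proof (intro equalityI subsetI)
  fix T assume "T \<in> {T. increasing_tree V T}"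
  then obtain f where f: "parent_tree V (Min V) f" "T = parent_graph V {Min V} f"
    by (auto elim: increasing_tree_parent)
  interpret parent_tree V "Min V" f
    by (rule f(1))
  have "restrict f (V - {Min V}) \<in> parent_functions V"
    using parent_in parent_less by (auto simp: parent_functions_def)
  moreover have "T = parent_graph V {Min V} (restrict f (V - {Min V}))"
    unfolding f(2) by (rule parent_graph_cong) simp
  ultimately show "T \<in> parent_graph V {Min V} ` parent_functions V"
    by blast
next
  fix T assume "T \<in> parent_graph V {Min V} ` parent_functions V"
  then show "T \<in> {T. increasing_tree V T}"
    using parent_tree.increasing[OF parent_tree_if_parent_function[OF assms]] by auto
qed

lemma inj_on_parent_functions:
  assumes "finite V" "V \<noteq> {}"
  shows "inj_on (parent_graph V {Min V}) (parent_functions V)"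
proof (rule inj_onI)
  fix f g assume f: "f \<in> parent_functions V" and g: "g \<in> parent_functions V"
    and eq: "parent_graph V {Min V} f = parent_graph V {Min V} g"
  have "f v = g v" if "v \<in> V - {Min V}" for v
    using parent_graph_inject[OF _ _ eq that]
      parent_tree_if_parent_function[OF assms f] parent_tree_if_parent_function[OF assms g]
    by (simp add: parent_tree_def)
  moreover have "f \<in> extensional (V - {Min V})" "g \<in> extensional (V - {Min V})"
    using f g by (auto simp: parent_functions_def PiE_iff)
  ultimately show "f = g"
    by (intro extensionalityI)
qed

lemma starlike_parent_graph_iff:
  assumes "finite V" "V \<noteq> {}" "f \<in> parent_functions V"
  shows "starlike (parent_graph V {Min V} f) (Min V) \<longleftrightarrow>
    f \<in> placements (V - {Min V}) (\<lambda>i. {u \<in> V - {Min V}. u < i}) (Min V)"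
  unfolding parent_tree.starlike_iff[OF parent_tree_if_parent_function[OF assms]]
  using assms(3) unfolding placements_def parent_functions_def by blast

lemma children_root_eq:
  assumes "finite V" "V \<noteq> {}" "f \<in> parent_functions V"
  shows "children (parent_graph V {Min V} f) (Min V) (Min V) = {i \<in> V - {Min V}. f i = Min V}"
  by (rule parent_tree.children_eq[OF parent_tree_if_parent_function[OF assms]])

lemma starlike_trees_eq:
  fixes V :: "'a::linorder set"
  assumes "finite V" "V \<noteq> {}"
  defines "r \<equiv> Min V"
  shows "{S. increasing_tree V S \<and> starlike S r \<and> card (children S r r) = m} =
    parent_graph V {r} ` {f \<in> placements (V - {r}) (\<lambda>i. {u \<in> V - {r}. u < i}) r.
      card {i \<in> V - {r}. f i = r} = m}"
proof -
  have "{S. increasing_tree V S \<and> starlike S r \<and> card (children S r r) = m} =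
      {S \<in> parent_graph V {r} ` parent_functions V. starlike S r \<and> card (children S r r) = m}"
    using increasing_trees_eq[OF assms(1,2)] by (auto simp: r_def)
  also have "\<dots> = parent_graph V {r} ` {f \<in> parent_functions V.
      starlike (parent_graph V {r} f) r \<and> card (children (parent_graph V {r} f) r r) = m}"
    by auto
  also have "{f \<in> parent_functions V.
      starlike (parent_graph V {r} f) r \<and> card (children (parent_graph V {r} f) r r) = m} =
      {f \<in> parent_functions V. f \<in> placements (V - {r}) (\<lambda>i. {u \<in> V - {r}. u < i}) r \<and>
        card {i \<in> V - {r}. f i = r} = m}"
    using starlike_parent_graph_iff[OF assms(1,2)] children_root_eq[OF assms(1,2)]
    by (intro Collect_cong) (auto simp: r_def)
  also have "\<dots> = {f \<in> placements (V - {r}) (\<lambda>i. {u \<in> V - {r}. u < i}) r.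
      card {i \<in> V - {r}. f i = r} = m}"
    by (auto simp: placements_def parent_functions_def r_def)
  finally show ?thesis .
qed

text \<open>Only the size of \<open>V\<close> enters. The vertex set of the tree at \<open>0\<close>
  varies with \<open>T\<close>, and this uniformity is what lets the factors multiply in
  \<open>card_triples\<close>.\<close>

lemma card_starlike_trees:
  fixes V :: "'a::linorder set"
  assumes "finite V" "V \<noteq> {}"
  shows "finite {S. increasing_tree V S \<and> starlike S (Min V) \<and> card (children S (Min V) (Min V)) = m}"
    "card {S. increasing_tree V S \<and> starlike S (Min V) \<and> card (children S (Min V) (Min V)) = m} =
      Stirling (card V - 1) m"
proof -
  let ?r = "Min V"
  let ?P = "placements (V - {?r}) (\<lambda>i. {u \<in> V - {?r}. u < i}) ?r"
  have fin: "finite ?P"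
    using assms(1) by (intro finite_placements) auto
  then show "finite {S. increasing_tree V S \<and> starlike S ?r \<and> card (children S ?r ?r) = m}"
    unfolding starlike_trees_eq[OF assms] by simp
  have less: "?r < i" if "i \<in> V - {?r}" for i
    using that assms(1) by (metis DiffE Min_le insertI1 le_neq_trans)
  have "{f \<in> ?P. card {i \<in> V - {?r}. f i = ?r} = m} \<subseteq> parent_functions V"
    by (auto simp: placements_def parent_functions_def)
  then have "inj_on (parent_graph V {?r}) {f \<in> ?P. card {i \<in> V - {?r}. f i = ?r} = m}"
    by (rule inj_on_subset[OF inj_on_parent_functions[OF assms]])
  then have "card {S. increasing_tree V S \<and> starlike S ?r \<and> card (children S ?r ?r) = m} =
      card {f \<in> ?P. card {i \<in> V - {?r}. f i = ?r} = m}"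
    unfolding starlike_trees_eq[OF assms] by (rule card_image)
  also have "\<dots> = Stirling (card (V - {?r})) m"
    using assms(1) less by (intro card_starlike_parent_functions) auto
  finally show "card {S. increasing_tree V S \<and> starlike S ?r \<and> card (children S ?r ?r) = m} =
      Stirling (card V - 1) m"
    using assms by simp
qed

lemma Min_atLeastAtMost_0: "Min {0..p::nat} = 0"
  by (rule Min_eqI) auto

lemma atLeastAtMost_minus_0: "{0..p::nat} - {0} = {1..p}"
  by auto

lemma parent_functions_atMost:
  "parent_functions {0..p} = Pi\<^sub>E {1..p} (\<lambda>i::nat. insert 0 {1..<i})"
proof -
  have "{u \<in> {1..p}. u < i} = {1..<i}" if "i \<in> {1..p}" for i :: nat
    using that by auto
  then show ?thesis
    unfolding parent_functions_def Min_atLeastAtMost_0 atLeastAtMost_minus_0 by (intro PiE_cong) simp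
qed

lemma card_increasing_trees:
  "finite {T. increasing_tree {0..p} T \<and> card (children T 0 0) = j}"
  "card {T. increasing_tree {0..p} T \<and> card (children T 0 0) = j} = stirling p j"
proof -
  let ?G = "parent_graph {0..p} {0}" and ?P = "parent_functions {0..p}"
  let ?Q = "{f \<in> ?P. card {i \<in> {1..p}. f i = 0} = j}"
  have fin: "finite ?P"
    unfolding parent_functions_atMost by (intro finite_PiE) auto
  have trees: "{T. increasing_tree {0..p} T} = ?G ` ?P"
    using increasing_trees_eq[of "{0..p}"] by (simp add: Min_atLeastAtMost_0)
  have ch: "children (?G f) 0 0 = {i \<in> {1..p}. f i = 0}" if "f \<in> ?P" for f
    using children_root_eq[of "{0..p}" f] that
    by (simp only: Min_atLeastAtMost_0 atLeastAtMost_minus_0) auto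
  have eq: "{T. increasing_tree {0..p} T \<and> card (children T 0 0) = j} = ?G ` ?Q"
  proof -
    have "{T. increasing_tree {0..p} T \<and> card (children T 0 0) = j} =
        {T \<in> ?G ` ?P. card (children T 0 0) = j}"
      using trees by auto
    also have "\<dots> = ?G ` ?Q"
      using ch by auto
    finally show ?thesis .
  qed
  show "finite {T. increasing_tree {0..p} T \<and> card (children T 0 0) = j}"
    unfolding eq using fin by simp
  have "inj_on ?G ?P"
    using inj_on_parent_functions[of "{0..p}"] by (simp add: Min_atLeastAtMost_0)
  then have "inj_on ?G ?Q"
    by (rule inj_on_subset) auto
  then have "card (?G ` ?Q) = card ?Q"
    by (rule card_image)
  then show "card {T. increasing_tree {0..p} T \<and> card (children T 0 0) = j} = stirling p j"
    unfolding eq using card_parent_functions[of p j] by (simp only: parent_functions_atMost)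
qed

lemma increasing_tree_atMost_cases:
  fixes p :: nat
  assumes "increasing_tree {0..p} T"
  obtains f where "parent_tree {0..p} 0 f" "T = parent_graph {0..p} {0} f"
  using increasing_tree_parent[OF assms] by (auto simp: Min_atLeastAtMost_0)

lemma card_colourings:
  assumes "increasing_tree {0..p} T" "card (children T 0 0) = j" "k \<ge> 1"
  shows "finite (colourings k T)" "card (colourings k T) = (k - 1) ^ (p - j)"
proof -
  obtain f where f: "parent_tree {0..p} 0 f" "T = parent_graph {0..p} {0} f"
    using assms(1) by (rule increasing_tree_atMost_cases)
  interpret parent_tree "{0..p}" 0 f
    by (rule f(1))
  have E: "edges T = (\<lambda>v. {f v, v}) ` {1..p}"
    unfolding f(2) edges_parent_graph atLeastAtMost_minus_0 ..
  have less: "f v < v" if "v \<in> {1..p}" for v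
    using parent_less[of v] that by auto
  \<comment> \<open>Edges correspond to their larger endpoints, so the product over edges becomes
    one over \<open>{1..p}\<close>, with factor \<open>1\<close> at each of the \<open>j\<close>
    children of the root.\<close>
  have inj: "inj_on (\<lambda>v. {f v, v}) {1..p}"
  proof (rule inj_onI)
    fix v w assume "v \<in> {1..p}" "w \<in> {1..p}" "{f v, v} = {f w, w}"
    then show "v = w"
      using less[of v] less[of w] by (auto simp: doubleton_eq_iff)
  qed
  have j: "card {v \<in> {1..p}. f v = 0} = j"
    using assms(2) unfolding f(2) children_eq atLeastAtMost_minus_0 .
  have C: "colourings k T = Pi\<^sub>E (edges T) (\<lambda>e. if 0 \<in> e then {0} else {1..<k})"
  proof (intro equalityI subsetI)
    fix C assume C: "C \<in> colourings k T"
    have "C e \<in> (if 0 \<in> e then {0} else {1..<k})" if "e \<in> edges T" for e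
      using C that by (auto simp: colourings_def PiE_iff Suc_le_eq)
    then show "C \<in> Pi\<^sub>E (edges T) (\<lambda>e. if 0 \<in> e then {0} else {1..<k})"
      using C by (simp add: colourings_def PiE_iff)
  next
    fix C assume C: "C \<in> Pi\<^sub>E (edges T) (\<lambda>e. if 0 \<in> e then {0} else {1..<k})"
    have "C e \<in> {0..<k} \<and> (C e = 0 \<longleftrightarrow> 0 \<in> e)" if "e \<in> edges T" for e
      using PiE_mem[OF C that] assms(3) by (auto split: if_splits)
    then show "C \<in> colourings k T"
      using C by (simp add: colourings_def PiE_iff)
  qed
  show "finite (colourings k T)"
    unfolding C by (intro finite_PiE) (auto simp: E)
  have "card (colourings k T) = (\<Prod>e\<in>edges T. card (if 0 \<in> e then {0} else {1..<k}))"
    unfolding C by (rule card_PiE) (simp add: E)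
  also have "\<dots> = (\<Prod>v\<in>{1..p}. card (if 0 \<in> {f v, v} then {0} else {1..<k}))"
    unfolding E by (simp only: prod.reindex[OF inj] o_def)
  also have "\<dots> = (\<Prod>v\<in>{1..p}. if f v = 0 then 1 else k - 1)"
    by (rule prod.cong) auto
  also have "\<dots> = (k - 1) ^ card {v \<in> {1..p}. f v \<noteq> 0}"
    by (simp add: prod.If_cases Int_def)
  also have "{v \<in> {1..p}. f v \<noteq> 0} = {1..p} - {v \<in> {1..p}. f v = 0}"
    by auto
  also have "card \<dots> = p - j"
    using j by (subst card_Diff_subset) auto
  finally show "card (colourings k T) = (k - 1) ^ (p - j)" .
qed

definition star_verts :: "nat \<Rightarrow> nat graph \<Rightarrow> int set" where
  "star_verts k T = {0} \<union> {ball_vertex k v |v. {0, v} \<in> edges T}"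

lemma star_verts:
  assumes "increasing_tree {0..p} T" "k \<ge> 1"
  shows "finite (star_verts k T)" "Min (star_verts k T) = 0"
    "card (star_verts k T) = Suc (card (children T 0 0))" "children T 0 0 \<subseteq> {1..p}"
proof -
  obtain f where f: "parent_tree {0..p} 0 f" "T = parent_graph {0..p} {0} f"
    using assms(1) by (rule increasing_tree_atMost_cases)
  interpret parent_tree "{0..p}" 0 f
    by (rule f(1))
  have ch: "children T 0 0 = {v \<in> {1..p}. f v = 0}"
    unfolding f(2) children_eq atLeastAtMost_minus_0 ..
  then show "children T 0 0 \<subseteq> {1..p}"
    by auto
  have "{0, v} \<in> edges T \<longleftrightarrow> v \<in> children T 0 0" for v
  proof (cases "v = 0")
    case True
    have "{f w, w} \<noteq> {0}" if "w \<in> {1..p}" for w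
      using that by auto
    then have "{0} \<notin> edges T"
      unfolding f(2) edges_parent_graph atLeastAtMost_minus_0 by blast
    then show ?thesis
      using True ch by simp
  next
    case False
    then show ?thesis
      using edge_iff[of 0 v] unfolding f(2) ch[unfolded f(2)] by auto
  qed
  then have W: "star_verts k T = insert 0 (ball_vertex k ` children T 0 0)"
    by (auto simp: star_verts_def)
  have pos: "ball_vertex k v \<ge> 1" if "v \<in> children T 0 0" for v
    using that ch by (intro ball_vertex_pos) simp
  have fin: "finite (children T 0 0)"
    using ch by simp
  then show "finite (star_verts k T)"
    using W by simp
  show "Min (star_verts k T) = 0"
    unfolding W using fin pos by (intro Min_eqI) force+
  have "card (ball_vertex k ` children T 0 0) = card (children T 0 0)"
    using assms(2) by (intro card_image) (auto simp: inj_on_def ball_vertex_eq_iff)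
  moreover have "0 \<notin> ball_vertex k ` children T 0 0"
    using pos by force
  ultimately show "card (star_verts k T) = Suc (card (children T 0 0))"
    unfolding W using fin by simp
qed

lemma card_triples:
  assumes "k \<ge> 1"
  shows "finite {((T, C), S). ((T, C), S) \<in> triples p k \<and>
      card (children T 0 0) = j \<and> card (children S 0 0) = m}" (is "finite ?X")
    "card {((T, C), S). ((T, C), S) \<in> triples p k \<and>
      card (children T 0 0) = j \<and> card (children S 0 0) = m} =
      stirling p j * Stirling j m * (k - 1) ^ (p - j)"
proof -
  define Ts where "Ts = {T. increasing_tree {0..p} T \<and> card (children T 0 0) = j}"
  define Ss where "Ss T = {S. increasing_tree (star_verts k T) S \<and> starlike S 0 \<and>
    card (children S 0 0) = m}" for T
  \<comment> \<open>Both the colourings and the trees at \<open>0\<close> depend on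
    \<open>T\<close>, but not on each other.\<close>
  have X: "?X = (SIGMA TC:(SIGMA T:Ts. colourings k T). Ss (fst TC))"
    by (auto simp: triples_def Ts_def Ss_def star_verts_def)
  have S: "finite (Ss T) \<and> card (Ss T) = Stirling j m" if "T \<in> Ts" for T
  proof -
    have T: "increasing_tree {0..p} T" "card (children T 0 0) = j"
      using that by (auto simp: Ts_def)
    have "star_verts k T \<noteq> {}"
      by (simp add: star_verts_def)
    then show ?thesis
      using card_starlike_trees[of "star_verts k T" m] star_verts[OF T(1) assms] T(2)
      by (simp add: Ss_def)
  qed
  have C: "finite (colourings k T) \<and> card (colourings k T) = (k - 1) ^ (p - j)" if "T \<in> Ts" for T
    using card_colourings[of p T j k] that assms by (auto simp: Ts_def)
  have T: "finite Ts" "card Ts = stirling p j"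
    using card_increasing_trees by (auto simp: Ts_def)
  have fin: "finite (SIGMA T:Ts. colourings k T)"
    using T C by blast
  show "finite ?X"
    unfolding X by (rule finite_SigmaI[OF fin]) (use S in auto)
  have "card ?X = (\<Sum>TC\<in>(SIGMA T:Ts. colourings k T). card (Ss (fst TC)))"
    unfolding X by (rule card_SigmaI, rule fin) (use S in auto)
  also have "\<dots> = (\<Sum>TC\<in>(SIGMA T:Ts. colourings k T). Stirling j m)"
    using S by (intro sum.cong) auto
  also have "\<dots> = card (SIGMA T:Ts. colourings k T) * Stirling j m"
    by simp
  also have "card (SIGMA T:Ts. colourings k T) = (\<Sum>T\<in>Ts. card (colourings k T))"
    using T C by (intro card_SigmaI) auto
  also have "\<dots> = (\<Sum>T\<in>Ts. (k - 1) ^ (p - j))"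
    using C by (intro sum.cong) auto
  finally show "card ?X = stirling p j * Stirling j m * (k - 1) ^ (p - j)"
    using T by simp
qed

text \<open>Shows that the classes with \<open>m \<le> j \<le> p\<close> exhaust all triples: the
  children of \<open>0\<close> in \<open>S\<close> are among its non-root vertices, and there are as
  many of these as children of \<open>0\<close> in \<open>T\<close>.\<close>

lemma triples_children_bounds:
  assumes "k \<ge> 1" "((T, C), S) \<in> triples p k"
  shows "card (children T 0 0) \<in> {card (children S 0 0)..p}"
proof -
  have T: "increasing_tree {0..p} T" and S: "increasing_tree (star_verts k T) S"
    using assms(2) by (auto simp: triples_def star_verts_def)
  note W = star_verts[OF T assms(1)]
  obtain f where f: "parent_tree (star_verts k T) 0 f" "S = parent_graph (star_verts k T) {0} f"
    using increasing_tree_parent[OF S] W(2) by auto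
  have le: "card (children S 0 0) \<le> card (star_verts k T - {0})"
    unfolding f(2) parent_tree.children_eq[OF f(1)] using W(1) by (intro card_mono) auto
  have "0 \<in> star_verts k T"
    by (simp add: star_verts_def)
  with le have "card (children S 0 0) \<le> card (children T 0 0)"
    using W(3) by (simp add: card_Diff_singleton)
  moreover have "card (children T 0 0) \<le> p"
    using card_mono[OF finite_atLeastAtMost W(4)] by simp
  ultimately show ?thesis
    by simp
qed

section \<open>From equal counts to the bijection\<close>

lemma card_pk_forests:
  assumes "p \<ge> 1" "k \<ge> 1"
  shows "card {F \<in> pk_forests p k. card (children (subtree F 0) 0 0) = m} = normal_coeff k p m"
proof -
  let ?D = "{d \<in> distributions p k. card {i \<in> {1..p}. d i = 0} = m}"
  have "card (children (subtree (dist_forest p k d) 0) 0 0) = card {i \<in> {1..p}. d i = 0}"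
    if "d \<in> distributions p k" for d
    using distribution.card_children_subtree_0[of p k d] assms that by (simp add: distribution_def)
  then have "{F \<in> pk_forests p k. card (children (subtree F 0) 0 0) = m} = dist_forest p k ` ?D"
    unfolding pk_forests_eq[OF assms] by auto
  moreover have "inj_on (dist_forest p k) ?D"
    by (rule inj_on_subset[OF inj_on_dist_forest[OF assms]]) auto
  ultimately show ?thesis
    using card_distributions[OF assms(2)] by (simp add: card_image)
qed

text \<open>The last component of \<open>Xi p k F\<close> is the tree of \<open>F\<close> at
  \<open>0\<close>, so the number of its root children is preserved and each class is mapped into
  the class of the same \<open>m\<close>.\<close>

lemma bij_betw_Xi_children:
  assumes "p \<ge> 1" "k \<ge> 1"
  shows "bij_betw (Xi p k) {F \<in> pk_forests p k. card (children (subtree F 0) 0 0) = m}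
    (\<Union>j\<in>{m..p}. {((T, C), S). ((T, C), S) \<in> triples p k \<and>
      card (children T 0 0) = j \<and> card (children S 0 0) = m})"
    (is "bij_betw _ ?F (\<Union>j\<in>_. ?X j)")
proof -
  have inj: "inj_on (Xi p k) ?F"
    by (rule inj_on_subset[OF inj_on_Xi[OF assms]]) auto
  have "Xi p k ` ?F \<subseteq> (\<Union>j\<in>{m..p}. ?X j)"
  proof
    fix t assume "t \<in> Xi p k ` ?F"
    then obtain F where F: "F \<in> pk_forests p k" "card (children (subtree F 0) 0 0) = m" "t = Xi p k F"
      by blast
    then obtain d where "d \<in> distributions p k" "F = dist_forest p k d"
      unfolding pk_forests_eq[OF assms] by blast
    then have t: "t \<in> triples p k"
      using distribution.Xi_in_triples[of p k d] assms F by (simp add: distribution_def)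
    obtain T C S where TCS: "t = ((T, C), S)"
      by (metis prod.exhaust)
    then have "S = subtree F 0"
      using F by (simp add: Xi_def)
    then show "t \<in> (\<Union>j\<in>{m..p}. ?X j)"
      using triples_children_bounds[OF assms(2), of T C S p] t F(2) TCS by auto
  qed
  moreover have "finite (\<Union>j\<in>{m..p}. ?X j)"
    using card_triples(1)[OF assms(2)] by blast
  moreover have "card (\<Union>j\<in>{m..p}. ?X j) = card (Xi p k ` ?F)"
  proof -
    have "card (\<Union>j\<in>{m..p}. ?X j) = (\<Sum>j=m..p. card (?X j))"
      using card_triples(1)[OF assms(2)] by (intro card_UN_disjoint) auto
    also have "\<dots> = normal_coeff k p m"
      unfolding card_triples(2)[OF assms(2)] normal_coeff_eq_sum ..
    finally show ?thesis
      using card_pk_forests[OF assms] inj by (simp add: card_image)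
  qed
  ultimately have "Xi p k ` ?F = (\<Union>j\<in>{m..p}. ?X j)"
    by (intro card_subset_eq) auto
  with inj show ?thesis
    by (simp add: bij_betw_def)
qed

lemma bij_betw_Xi:
  assumes "p \<ge> 1" "k \<ge> 1"
  shows "bij_betw (Xi p k) (pk_forests p k) (triples p k)"
proof -
  let ?F = "\<lambda>m. {F \<in> pk_forests p k. card (children (subtree F 0) 0 0) = m}"
  let ?X = "\<lambda>m. \<Union>j\<in>{m..p}. {((T, C), S). ((T, C), S) \<in> triples p k \<and>
      card (children T 0 0) = j \<and> card (children S 0 0) = m}"
  \<comment> \<open>Every triple lies in the class of its own \<open>m\<close>, so surjectivity onto
    each class adds up to surjectivity onto \<open>triples p k\<close>.\<close>
  have "triples p k = (\<Union>m. ?X m)"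
    using triples_children_bounds[OF assms(2)] by fastforce
  also have "\<dots> = (\<Union>m. Xi p k ` ?F m)"
    using bij_betw_Xi_children[OF assms] by (simp add: bij_betw_def)
  also have "\<dots> = Xi p k ` pk_forests p k"
    by auto
  finally show ?thesis
    using inj_on_Xi[OF assms] by (simp add: bij_betw_def)
qed

theorem theorem15:
  fixes p k :: nat
  assumes "p \<ge> 1" and "k \<ge> 1"
  shows "bij_betw (Xi p k) (pk_forests p k) (triples p k) \<and>
    (\<forall>m\<in>{1..p}.
      alpha p k m = real (card {d \<in> distributions p k. card {i \<in> {1..p}. d i = 0} = m}) \<and>
      alpha p k m = real (card {F \<in> pk_forests p k. card (children (subtree F 0) 0 0) = m}) \<and>
      bij_betw (Xi p k)
        {F \<in> pk_forests p k. card (children (subtree F 0) 0 0) = m}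
        (\<Union>j\<in>{m..p}. {((T, C), S). ((T, C), S) \<in> triples p k \<and>
           card (children T 0 0) = j \<and> card (children S 0 0) = m}) \<and>
      (\<forall>j\<in>{m..p}. card {((T, C), S). ((T, C), S) \<in> triples p k \<and>
           card (children T 0 0) = j \<and> card (children S 0 0) = m} =
         stirling p j * Stirling j m * (k - 1) ^ (p - j)) \<and>
      alpha p k m = real (\<Sum>j=m..p. stirling p j * Stirling j m * (k - 1) ^ (p - j)))"
proof (intro conjI ballI)
  show "bij_betw (Xi p k) (pk_forests p k) (triples p k)"
    by (rule bij_betw_Xi[OF assms])
next
  fix m assume m: "m \<in> {1..p}"
  note alpha = alpha_eq_normal_coeff[OF assms m]
  show "alpha p k m = real (card {d \<in> distributions p k. card {i \<in> {1..p}. d i = 0} = m})"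
    unfolding alpha card_distributions[OF assms(2)] ..
  show "alpha p k m = real (card {F \<in> pk_forests p k. card (children (subtree F 0) 0 0) = m})"
    unfolding alpha card_pk_forests[OF assms] ..
  show "alpha p k m = real (\<Sum>j=m..p. stirling p j * Stirling j m * (k - 1) ^ (p - j))"
    unfolding alpha normal_coeff_eq_sum ..
qed (rule bij_betw_Xi_children[OF assms] card_triples(2)[OF assms(2)])+

end
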